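(* Let $n\ge 2$, let $R$ be a non-singular $n\times n$ correlation matrix whose inverse $R^{-1}=(r^{ij})$ is of tree type, and let $\alpha>0$. Then the density of the $\Gamma_n(\alpha,R)$-distribution on $(0,\infty)^n$, which is proportional to $$\Big(\prod_{i=1}^n x_i^{\alpha-1}e^{-r^{ii}x_i}\Big)\prod_{1\le i<j\le n}{}_0F_1\big(\alpha;(r^{ij})^2x_ix_j\big),$$ is MTP$_2$ on $(0,\infty)^n$. Consequently the cumulative distribution function of the $\Gamma_n(\alpha,R)$-distribution is MTP$_2$ on $(0,\infty)^n$ too, and if $(X_1,\dots,X_n)$ has the $\Gamma_n(\alpha,R)$-distribution, then for all $0<x_i\le b_i$ $(i=1,\dots,n)$ and every nonempty proper subset $I\subset\{1,\dots,n\}$, with $A_i=\{X_i\le x_i\}$ and $B_i=\{X_i\le b_i\}$, $$\frac{P\left(\bigcap_{i=1}^n A_i\right)}{P\left(\bigcap_{i\in I}A_i\right)P\left(\bigcap_{i\notin I}A_i\right)}\ \ge\ \frac{P\left(\bigcap_{i=1}^n B_i\right)}{P\left(\bigcap_{i\in I}B_i\right)P\left(\bigcap_{i\notin I}B_i\right)}.$$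
   Context: For a non-singular $n\times n$ correlation matrix $R$ and $\alpha>0$, the $\Gamma_n(\alpha,R)$-distribution is the probability distribution on $(0,\infty)^n$ with Laplace transform $E\exp(-\sum_i t_iX_i)=|I_n+RT|^{-\alpha}$, $T=\mathrm{Diag}(t_1,\dots,t_n)$, $t_i\ge 0$ ($|\cdot|$ denotes the determinant), whenever it exists; for $R^{-1}$ of tree type it exists for all $\alpha>0$. The matrix $R^{-1}=(r^{ij})$ is of tree type if the graph with vertices $\{1,\dots,n\}$ and an edge $\{i,j\}$, $i\ne j$, exactly when $r^{ij}\neq0$, is a spanning tree (connected, without cycles, $n-1$ edges). ${}_0F_1(\alpha;z)=\sum_{k=0}^\infty\frac{z^k}{(\alpha)_kk!}$ with $(\alpha)_k=\alpha(\alpha+1)\cdots(\alpha+k-1)$. An everywhere positive function $F$ on $(0,\infty)^n$ is MTP$_2$ if $F(\vec{x}\vee\vec{y})F(\vec{x}\wedge\vec{y})\ge F(\vec{x})F(\vec{y})$ for all $\vec{x},\vec{y}\in(0,\infty)^n$, where $\vee,\wedge$ are componentwise maximum and minimum. *)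

theory Defs
  imports "HOL-Probability.Probability"
begin

definition correlation_matrix :: "real ^ 'n ^ 'n \<Rightarrow> bool" where
  "correlation_matrix R \<longleftrightarrow>
     transpose R = R \<and> (\<forall>i. R $ i $ i = 1) \<and> (\<forall>v. 0 \<le> v \<bullet> (R *v v))"

definition diag_matrix :: "real ^ 'n \<Rightarrow> real ^ 'n ^ 'n" where
  "diag_matrix t = (\<chi> i j. if i = j then t $ i else 0)"

definition matrix_graph_edges :: "real ^ 'n ^ 'n \<Rightarrow> 'n set set" where
  "matrix_graph_edges A = {{i, j} |i j. i \<noteq> j \<and> A $ i $ j \<noteq> 0}"

text \<open>
  A cycle is given by the list of its at least three distinct vertices, where the last one
  is again adjacent to the first one.
\<close>

definition graph_cycle :: "'n set set \<Rightarrow> 'n list \<Rightarrow> bool" where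
  "graph_cycle E vs \<longleftrightarrow>
     3 \<le> length vs \<and> distinct vs \<and>
     (\<forall>k < length vs. {vs ! k, vs ! (Suc k mod length vs)} \<in> E)"

definition tree_type :: "real ^ 'n ^ 'n \<Rightarrow> bool" where
  "tree_type A \<longleftrightarrow>
     (\<forall>i j. (i, j) \<in> {(u, v). {u, v} \<in> matrix_graph_edges A}\<^sup>*) \<and>
     (\<nexists>vs. graph_cycle (matrix_graph_edges A) vs) \<and>
     card (matrix_graph_edges A) = CARD('n) - 1"

definition hypergeom_0F1 :: "real \<Rightarrow> real \<Rightarrow> real" where
  "hypergeom_0F1 \<alpha> z = (\<Sum>k. z ^ k / (pochhammer \<alpha> k * fact k))"

definition pos_orthant :: "(real ^ 'n) set" where
  "pos_orthant = {x. \<forall>i. 0 < x $ i}"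

definition multivariate_gamma :: "real \<Rightarrow> real ^ 'n ^ 'n \<Rightarrow> (real ^ 'n) measure \<Rightarrow> bool" where
  "multivariate_gamma \<alpha> R M \<longleftrightarrow>
     prob_space M \<and> sets M = sets borel \<and> (AE x in M. x \<in> pos_orthant) \<and>
     (\<forall>t. (\<forall>i. 0 \<le> t $ i) \<longrightarrow>
        (\<integral>x. exp (- (\<Sum>i\<in>UNIV. t $ i * x $ i)) \<partial>M) =
          det (mat 1 + R ** diag_matrix t) powr (- \<alpha>))"

definition gamma_tree_kernel ::
  "real \<Rightarrow> real ^ 'n::{finite, linorder} ^ 'n::{finite, linorder} \<Rightarrow>
     real ^ 'n::{finite, linorder} \<Rightarrow> real" where
  "gamma_tree_kernel \<alpha> R x =
     (\<Prod>i\<in>UNIV. (x $ i) powr (\<alpha> - 1) * exp (- (matrix_inv R $ i $ i * x $ i))) *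
     (\<Prod>(i, j)\<in>{(i, j). i < j}. hypergeom_0F1 \<alpha> ((matrix_inv R $ i $ j)\<^sup>2 * x $ i * x $ j))"

text \<open>The operations \<^term>\<open>sup\<close> and \<^term>\<open>inf\<close> on vectors are the componentwise maximum and minimum.\<close>

definition MTP2 :: "(real ^ 'n \<Rightarrow> real) \<Rightarrow> bool" where
  "MTP2 F \<longleftrightarrow>
     (\<forall>x\<in>pos_orthant. 0 < F x) \<and>
     (\<forall>x\<in>pos_orthant. \<forall>y\<in>pos_orthant. F (sup x y) * F (inf x y) \<ge> F x * F y)"

definition joint_cdf :: "(real ^ 'n) measure \<Rightarrow> real ^ 'n \<Rightarrow> real" where
  "joint_cdf M x = measure M {y. \<forall>i. y $ i \<le> x $ i}"

end

theory Submission
  imports Defs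
begin

text \<open>
  Write \<open>Q\<close> for the inverse of \<open>R\<close>. Everything rests on two facts about the kernel
  \<open>\<Prod>i. x i powr (\<alpha> - 1) * exp (- Q i i * x i)\<close> times the factors \<open>0F1 (\<alpha>; (Q i j)\<^sup>2 * x i * x j)\<close>.

  The first is that its total mass is \<open>Gamma \<alpha> ^ n * det Q powr (- \<alpha>)\<close> whenever \<open>Q\<close> is
  positive definite with an acyclic graph (\<open>nn_integral_orthant_kernel\<close>). Integrating over the
  coordinate of a leaf \<open>i\<close> attached to \<open>j\<close> produces an exponential in \<open>x j\<close>, which replaces
  \<open>Q j j\<close> by the Schur complement \<open>Q j j - (Q i j)\<^sup>2 / Q i i\<close>. The same mass is obtained from
  the matrix in which the edge has been removed by symmetric Gaussian elimination, and this matrix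
  has the same determinant. Removing all edges leaves a product of one-dimensional gamma
  integrals. Applied to \<open>Q + T\<close>, the formula is the required Laplace transform, because
  \<open>mat 1 + R ** T = R ** (Q + T)\<close>. Hence the normalised kernel is a density with that transform, and
  the distribution is unique since a measure on the orthant is determined by its Laplace
  transform (\<open>measure_eq_of_laplace\<close>, by the Stone-Weierstrass theorem on the unit cube).

  The second is that the kernel is log-supermodular (\<open>gamma_tree_kernel_log_supermodular\<close>): a
  power series in \<open>x * y\<close> with nonnegative coefficients is a TP2 function of \<open>x\<close> and \<open>y\<close>.

  The four functions theorem of Ahlswede and Daykin, proved by integrating out one coordinate at
  a time, turns a log-supermodular density into the set inequality
  \<open>P A * P B \<le> P C * P D\<close> whenever joins of elements of \<open>A\<close> and \<open>B\<close> lie in \<open>C\<close> and meets in \<open>D\<close>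
  (\<open>emeasure_lattice_density\<close>). For sets bounding all coordinates from above this is the MTP2
  property of the distribution function. For sets that bound only the coordinates in \<open>I\<close>, or
  only those outside \<open>I\<close>, it gives the ratio inequality by lowering the thresholds from
  \<open>b\<close> to \<open>x\<close> first on \<open>I\<close> and then on the complement.
\<close>

section \<open>The four functions theorem\<close>

text \<open>
  For finite nonzero \<open>c\<close> this is \<open>0 \<le> (c - a) * (c - b)\<close>, expanded and divided by \<open>c\<close>.
\<close>

lemma ennreal_add_le_add_of_mult_le:
  fixes a b c d :: ennreal
  assumes "a \<le> c" "b \<le> c" "a * b \<le> c * d"
  shows "a + b \<le> c + d"
proof (cases "c = \<infinity> \<or> d = \<infinity>")
  case False
  then obtain c' d' where c: "c = ennreal c'" "c' \<ge> 0" and d: "d = ennreal d'" "d' \<ge> 0"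
    by (metis ennreal_cases infinity_ennreal_def)
  have "a < top" "b < top"
    using assms(1,2) c by (auto simp: less_top[symmetric] top_unique)
  then obtain a' b' where a: "a = ennreal a'" "a' \<ge> 0" and b: "b = ennreal b'" "b' \<ge> 0"
    by (metis ennreal_cases less_irrefl)
  have le: "a' \<le> c'" "b' \<le> c'" "a' * b' \<le> c' * d'"
    using assms a b c d by (auto simp: ennreal_mult[symmetric])
  have "a' + b' \<le> c' + d'"
  proof (cases "c' = 0")
    case True
    then show ?thesis using le a b d by simp
  next
    case False
    have "0 \<le> (c' - a') * (c' - b')" using le by simp
    then have "c' * (a' + b') \<le> c' * c' + a' * b'" by (simp add: algebra_simps)
    also have "\<dots> \<le> c' * (c' + d')" using le by (simp add: algebra_simps)
    finally show ?thesis using False c(2) by simp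
  qed
  then show ?thesis using a b c d by (simp flip: ennreal_plus)
qed auto

text \<open>
  On a chain, symmetrising the double integral of \<open>f1 x * f2 y\<close> under exchange of \<open>x\<close> and \<open>y\<close>
  reduces the claim to a pointwise one. With \<open>x \<le> y\<close>, both \<open>f1 x * f2 y\<close> and \<open>f1 y * f2 x\<close>
  are at most \<open>f3 y * f4 x\<close>, while their product is at most that of \<open>f3 y * f4 x\<close> and
  \<open>f3 x * f4 y\<close> by the hypothesis on the diagonal, so the preceding lemma applies. Because
  the pointwise bound includes \<open>x = y\<close>, the diagonal may have positive mass.
\<close>

lemma four_functions_linorder:
  fixes f1 f2 f3 f4 :: "'a::{linorder,lattice} \<Rightarrow> ennreal"
  assumes [measurable]: "f1 \<in> borel_measurable M" "f2 \<in> borel_measurable M"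
    "f3 \<in> borel_measurable M" "f4 \<in> borel_measurable M"
    and le: "\<And>x y. x \<in> space M \<Longrightarrow> y \<in> space M \<Longrightarrow>
      f1 x * f2 y \<le> f3 (sup x y) * f4 (inf x y)"
  shows "(\<integral>\<^sup>+x. f1 x \<partial>M) * (\<integral>\<^sup>+x. f2 x \<partial>M) \<le> (\<integral>\<^sup>+x. f3 x \<partial>M) * (\<integral>\<^sup>+x. f4 x \<partial>M)"
proof -
  have sym: "2 * ((\<integral>\<^sup>+x. f x \<partial>M) * (\<integral>\<^sup>+x. g x \<partial>M)) =
      (\<integral>\<^sup>+x. \<integral>\<^sup>+y. f x * g y + f y * g x \<partial>M \<partial>M)"
    if [measurable]: "f \<in> borel_measurable M" "g \<in> borel_measurable M" for f g :: "'a \<Rightarrow> ennreal"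
  proof -
    have "(\<integral>\<^sup>+x. \<integral>\<^sup>+y. f x * g y + f y * g x \<partial>M \<partial>M)
        = (\<integral>\<^sup>+x. f x * (\<integral>\<^sup>+y. g y \<partial>M) + (\<integral>\<^sup>+y. f y \<partial>M) * g x \<partial>M)"
      by (simp add: nn_integral_add nn_integral_cmult nn_integral_multc)
    also have "\<dots> = 2 * ((\<integral>\<^sup>+x. f x \<partial>M) * (\<integral>\<^sup>+x. g x \<partial>M))"
      by (simp add: nn_integral_add nn_integral_cmult nn_integral_multc mult_2)
    finally show ?thesis by simp
  qed
  have "f1 x * f2 y + f1 y * f2 x \<le> f3 x * f4 y + f3 y * f4 x"
    if "x \<in> space M" "y \<in> space M" for x y
  proof -
    have *: "f1 x * f2 y + f1 y * f2 x \<le> f3 y * f4 x + f3 x * f4 y"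
      if "x \<le> y" "x \<in> space M" "y \<in> space M" for x y
    proof (rule ennreal_add_le_add_of_mult_le)
      show "f1 x * f2 y \<le> f3 y * f4 x" "f1 y * f2 x \<le> f3 y * f4 x"
        using le[of x y] le[of y x] that by (simp_all add: sup_absorb1 sup_absorb2 inf_absorb1 inf_absorb2)
      have "(f1 x * f2 x) * (f1 y * f2 y) \<le> (f3 x * f4 x) * (f3 y * f4 y)"
        using le[of x x] le[of y y] that by (auto intro!: mult_mono[of "f1 x * f2 x"])
      then show "f1 x * f2 y * (f1 y * f2 x) \<le> f3 y * f4 x * (f3 x * f4 y)"
        by (simp add: ac_simps)
    qed
    show ?thesis using *[of x y] *[of y x] that by (cases "x \<le> y") (auto simp: ac_simps)
  qed
  then have "2 * ((\<integral>\<^sup>+x. f1 x \<partial>M) * (\<integral>\<^sup>+x. f2 x \<partial>M)) \<le> 2 * ((\<integral>\<^sup>+x. f3 x \<partial>M) * (\<integral>\<^sup>+x. f4 x \<partial>M))"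
    unfolding sym[OF assms(1,2)] sym[OF assms(3,4)] by (intro nn_integral_mono)
  then show ?thesis
    by (simp add: ennreal_mult_le_mult_iff)
qed

text \<open>
  The four functions theorem of Ahlswede and Daykin for product measures. Integrating out a
  coordinate preserves the hypothesis by the one-dimensional case, which gives the induction.
\<close>

lemma four_functions_PiM:
  fixes f1 f2 f3 f4 :: "('i \<Rightarrow> 'a::{linorder,lattice}) \<Rightarrow> ennreal"
  assumes sf: "\<And>i. sigma_finite_measure (M i)" and "finite I"
    and "f1 \<in> borel_measurable (PiM I M)" "f2 \<in> borel_measurable (PiM I M)"
    "f3 \<in> borel_measurable (PiM I M)" "f4 \<in> borel_measurable (PiM I M)"
    and "\<And>x y. x \<in> space (PiM I M) \<Longrightarrow> y \<in> space (PiM I M) \<Longrightarrow>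
      f1 x * f2 y \<le> f3 (sup x y) * f4 (inf x y)"
  shows "(\<integral>\<^sup>+x. f1 x \<partial>PiM I M) * (\<integral>\<^sup>+x. f2 x \<partial>PiM I M)
      \<le> (\<integral>\<^sup>+x. f3 x \<partial>PiM I M) * (\<integral>\<^sup>+x. f4 x \<partial>PiM I M)"
  using assms(2-)
proof (induction I arbitrary: f1 f2 f3 f4 rule: finite_induct)
  case empty
  have "sup (\<lambda>_. undefined) (\<lambda>_. undefined) = (\<lambda>_. undefined :: 'a)"
    "inf (\<lambda>_. undefined) (\<lambda>_. undefined) = (\<lambda>_. undefined :: 'a)"
    by auto
  then show ?case
    using empty.prems(5)[of "\<lambda>_. undefined" "\<lambda>_. undefined"]
    by (simp add: PiM_empty nn_integral_count_space_finite)
next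
  case (insert i I)
  interpret product_sigma_finite M by (simp add: product_sigma_finite_def sf)
  note [measurable] = insert.prems(1-4)
  let ?g = "\<lambda>f x. \<integral>\<^sup>+y. f (x(i := y)) \<partial>M i"
  have upd: "sup (x(i := u)) (y(i := v)) = (sup x y)(i := sup u v)"
    "inf (x(i := u)) (y(i := v)) = (inf x y)(i := inf u v)" for x y :: "'i \<Rightarrow> 'a" and u v
    by (auto simp: fun_eq_iff)
  have sup_inf_in: "sup u v \<in> A" "inf u v \<in> A" if "u \<in> A" "v \<in> A" for u v :: 'a and A
    using that by (metis inf.absorb1 inf.absorb2 linear sup.absorb1 sup.absorb2)+
  have "integral\<^sup>N (PiM I M) (?g f1) * integral\<^sup>N (PiM I M) (?g f2)
    \<le> integral\<^sup>N (PiM I M) (?g f3) * integral\<^sup>N (PiM I M) (?g f4)"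
  proof (rule insert.IH)
    show "?g f1 x * ?g f2 y \<le> ?g f3 (sup x y) * ?g f4 (inf x y)"
      if x [measurable]: "x \<in> space (PiM I M)" and y [measurable]: "y \<in> space (PiM I M)" for x y
    proof (rule four_functions_linorder)
      have [measurable]: "sup x y \<in> space (PiM I M)" "inf x y \<in> space (PiM I M)"
        using x y sup_inf_in by (auto simp: space_PiM PiE_iff extensional_def)
      show "(\<lambda>u. f3 ((sup x y)(i := u))) \<in> borel_measurable (M i)"
        "(\<lambda>u. f4 ((inf x y)(i := u))) \<in> borel_measurable (M i)" by measurable
      show "f1 (x(i := u)) * f2 (y(i := v)) \<le> f3 ((sup x y)(i := sup u v)) * f4 ((inf x y)(i := inf u v))"
        if "u \<in> space (M i)" "v \<in> space (M i)" for u v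
        using insert.prems(5)[of "x(i := u)" "y(i := v)"] x y that
        by (simp only: upd space_PiM PiE_fun_upd)
    qed measurable
  qed measurable
  then show ?case
    by (simp add: product_nn_integral_insert insert.hyps insert.prems)
qed


lemma borel_measurable_vec_nth [measurable]: "(\<lambda>x::real ^ 'n. x $ i) \<in> borel_measurable borel"
  by (intro borel_measurable_continuous_onI continuous_intros)

lemma borel_measurable_vec_lambda [measurable (raw)]:
  fixes f :: "'a \<Rightarrow> 'n::finite \<Rightarrow> real"
  assumes "\<And>i. (\<lambda>x. f x i) \<in> borel_measurable M"
  shows "(\<lambda>x. \<chi> i. f x i) \<in> borel_measurable M"
  using assms by (subst borel_measurable_euclidean_space) (auto simp: Basis_vec_def inner_axis)

lemma lborel_vec_eq_distr_PiM:
  "(lborel :: (real ^ 'n) measure) = distr (\<Pi>\<^sub>M i\<in>UNIV. lborel) borel (\<lambda>f. \<chi> i. f i)"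
proof (rule lborel_eqI)
  interpret product_sigma_finite "\<lambda>_::'n. lborel :: real measure"
    by (simp add: product_sigma_finite_def sigma_finite_lborel)
  fix l u :: "real ^ 'n"
  assume le: "\<And>b. b \<in> Basis \<Longrightarrow> l \<bullet> b \<le> u \<bullet> b"
  have le': "l $ i \<le> u $ i" for i
    using le[of "axis i 1"] by (simp add: axis_in_Basis_iff inner_axis)
  have "(\<lambda>f. \<chi> i. f i) -` box l u \<inter> space (\<Pi>\<^sub>M i\<in>UNIV. lborel) = (\<Pi>\<^sub>E i\<in>UNIV. {l $ i <..< u $ i})"
    by (auto simp: mem_box_cart space_PiM PiE_iff)
  then have "emeasure (distr (\<Pi>\<^sub>M i\<in>UNIV. lborel) borel (\<lambda>f. \<chi> i. f i)) (box l u)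
    = (\<Prod>i\<in>UNIV. emeasure lborel {l $ i <..< u $ i})"
    by (subst emeasure_distr) (simp_all add: emeasure_PiM)
  also have "\<dots> = ennreal (\<Prod>i\<in>UNIV. u $ i - l $ i)"
    using le' by (simp add: prod_ennreal)
  also have "(\<Prod>i\<in>UNIV. u $ i - l $ i) = (\<Prod>b\<in>Basis. (u - l) \<bullet> b)"
  proof -
    have B: "(Basis :: (real ^ 'n) set) = range (\<lambda>i. axis i 1)"
      by (auto simp: Basis_vec_def)
    have "inj (\<lambda>i::'n. axis i (1::real))" by (auto simp: inj_def axis_eq_axis)
    then show ?thesis unfolding B by (simp add: prod.reindex inner_axis)
  qed
  finally show "emeasure (distr (\<Pi>\<^sub>M i\<in>UNIV. lborel) borel (\<lambda>f. \<chi> i. f i)) (box l u)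
    = ennreal (\<Prod>b\<in>Basis. (u - l) \<bullet> b)" .
qed simp

lemma nn_integral_lborel_vec:
  fixes f :: "real ^ 'n \<Rightarrow> ennreal"
  assumes [measurable]: "f \<in> borel_measurable borel"
  shows "(\<integral>\<^sup>+x. f x \<partial>lborel) = (\<integral>\<^sup>+x. f (\<chi> i. x i) \<partial>(\<Pi>\<^sub>M i\<in>UNIV. lborel))"
  by (subst lborel_vec_eq_distr_PiM, rule nn_integral_distr) measurable

text \<open>
  The consequence of the four functions theorem that serves all distribution function
  inequalities: it is applied to a log-supermodular density cut off by the four sets.
\<close>

lemma emeasure_lattice_density:
  fixes f :: "real ^ 'n \<Rightarrow> ennreal"
  assumes [measurable]: "f \<in> borel_measurable borel"
    and f: "\<And>x y. f x * f y \<le> f (sup x y) * f (inf x y)"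
    and [measurable]: "A \<in> sets borel" "B \<in> sets borel" "C \<in> sets borel" "D \<in> sets borel"
    and lat: "\<And>x y. x \<in> A \<Longrightarrow> y \<in> B \<Longrightarrow> sup x y \<in> C \<and> inf x y \<in> D"
  shows "emeasure (density lborel f) A * emeasure (density lborel f) B
    \<le> emeasure (density lborel f) C * emeasure (density lborel f) D"
proof -
  let ?F = "\<lambda>S (x :: 'n \<Rightarrow> real). f (\<chi> i. x i) * indicator S (\<chi> i. x i)"
  have eq: "emeasure (density lborel f) S = integral\<^sup>N (\<Pi>\<^sub>M i\<in>UNIV. lborel) (?F S)"
    if [measurable]: "S \<in> sets borel" for S
    using nn_integral_lborel_vec[of "\<lambda>x. f x * indicator S x"] by (subst emeasure_density) auto
  have "?F A x * ?F B y \<le> ?F C (sup x y) * ?F D (inf x y)" for x y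
  proof (cases "(\<chi> i. x i) \<in> A \<and> (\<chi> i. y i) \<in> B")
    case True
    have "(\<chi> i. sup x y i) = sup (\<chi> i. x i) (\<chi> i. y i)"
      "(\<chi> i. inf x y i) = inf (\<chi> i. x i) (\<chi> i. y i)"
      by (simp_all add: sup_vec_def inf_vec_def)
    then show ?thesis
      using True lat[of "\<chi> i. x i" "\<chi> i. y i"] f[of "\<chi> i. x i" "\<chi> i. y i"] by simp
  qed auto
  then show ?thesis
    unfolding eq[OF assms(3)] eq[OF assms(4)] eq[OF assms(5)] eq[OF assms(6)]
    by (intro four_functions_PiM sigma_finite_lborel) (measurable, simp only:)
qed

section \<open>The hypergeometric function 0F1\<close>

lemma summable_hypergeom_0F1:
  assumes "\<alpha> > 0"
  shows "summable (\<lambda>k. z ^ k / (pochhammer \<alpha> k * fact k) :: real)"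
proof (rule summable_ratio_test[of "1/2" "nat \<lceil>2 * \<bar>z\<bar>\<rceil>"])
  fix k assume k: "k \<ge> nat \<lceil>2 * \<bar>z\<bar>\<rceil>"
  then have "2 * \<bar>z\<bar> \<le> real k" by linarith
  also have "real k \<le> (\<alpha> + real k) * (1 + real k)"
    using assms by (simp add: algebra_simps)
  finally have "\<bar>z\<bar> / ((\<alpha> + real k) * (1 + real k)) \<le> 1/2"
    using assms by (simp add: divide_simps add_pos_nonneg)
  then have "\<bar>z\<bar> / ((\<alpha> + real k) * (1 + real k)) * norm (z ^ k / (pochhammer \<alpha> k * fact k))
    \<le> 1/2 * norm (z ^ k / (pochhammer \<alpha> k * fact k))"
    by (rule mult_right_mono) simp
  moreover have "norm (z ^ Suc k / (pochhammer \<alpha> (Suc k) * fact (Suc k)))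
    = \<bar>z\<bar> / ((\<alpha> + real k) * (1 + real k)) * norm (z ^ k / (pochhammer \<alpha> k * fact k))"
    using assms by (simp add: pochhammer_rec' abs_mult power_abs ac_simps)
  ultimately show "norm (z ^ Suc k / (pochhammer \<alpha> (Suc k) * fact (Suc k)))
    \<le> 1/2 * norm (z ^ k / (pochhammer \<alpha> k * fact k))" by simp
qed simp

lemma hypergeom_0F1_sums:
  assumes "\<alpha> > 0"
  shows "(\<lambda>k. z ^ k / (pochhammer \<alpha> k * fact k)) sums hypergeom_0F1 \<alpha> z"
  unfolding hypergeom_0F1_def using summable_hypergeom_0F1[OF assms] by (rule summable_sums)

lemma hypergeom_0F1_0 [simp]: "hypergeom_0F1 \<alpha> 0 = 1"
  unfolding hypergeom_0F1_def by (subst suminf_finite[of "{0}"]) auto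

lemma hypergeom_0F1_ge_1:
  assumes "\<alpha> > 0" "z \<ge> 0"
  shows "1 \<le> hypergeom_0F1 \<alpha> z"
proof -
  have "(\<Sum>k\<in>{0}. z ^ k / (pochhammer \<alpha> k * fact k)) \<le> hypergeom_0F1 \<alpha> z"
    unfolding hypergeom_0F1_def using assms
    by (intro sum_le_suminf summable_hypergeom_0F1) (auto intro!: divide_nonneg_pos mult_pos_pos pochhammer_pos)
  then show ?thesis by simp
qed

lemma borel_measurable_hypergeom_0F1 [measurable]: "hypergeom_0F1 \<alpha> \<in> borel_measurable borel"
  unfolding hypergeom_0F1_def by measurable

text \<open>
  The Cauchy-Binet argument: twice the difference of the two sides is the sum over \<open>k\<close> and \<open>l\<close>
  of \<open>a k * a l\<close> times two two-by-two minors of the kernel \<open>s ^ k\<close>, which always have the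
  same sign. Finite sums keep the exchange of summation elementary.
\<close>

lemma sum_powers_TP2:
  fixes a :: "nat \<Rightarrow> real"
  assumes a: "\<And>k. a k \<ge> 0" and x: "0 \<le> x" "x \<le> x'" and y: "0 \<le> y" "y \<le> y'"
  shows "(\<Sum>k<N. a k * (x * y') ^ k) * (\<Sum>k<N. a k * (x' * y) ^ k)
    \<le> (\<Sum>k<N. a k * (x * y) ^ k) * (\<Sum>k<N. a k * (x' * y') ^ k)"
proof -
  have mono: "s ^ l * t ^ k \<le> s ^ k * t ^ l" if "k \<le> l" "0 \<le> s" "s \<le> t" for k l and s t :: real
  proof -
    have "s ^ k * t ^ k * s ^ (l - k) \<le> s ^ k * t ^ k * t ^ (l - k)"
      using that by (intro mult_left_mono power_mono) auto
    moreover have "s ^ l = s ^ k * s ^ (l - k)" "t ^ l = t ^ k * t ^ (l - k)"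
      using that by (simp_all flip: power_add)
    ultimately show ?thesis
      by (simp add: ac_simps)
  qed
  have sign: "0 \<le> (x ^ k * x' ^ l - x ^ l * x' ^ k) * (y ^ k * y' ^ l - y ^ l * y' ^ k)" for k l
  proof (cases "k \<le> l")
    case True
    then show ?thesis using mono x y by (intro mult_nonneg_nonneg) auto
  next
    case False
    then show ?thesis using mono[of l k] x y by (intro mult_nonpos_nonpos) auto
  qed
  have dbl: "2 * ((\<Sum>k<N. a k * s ^ k) * (\<Sum>k<N. a k * t ^ k)) =
    (\<Sum>k<N. \<Sum>l<N. a k * a l * (s ^ k * t ^ l + s ^ l * t ^ k))" for s t :: real
  proof -
    have "(\<Sum>k<N. a k * s ^ k) * (\<Sum>k<N. a k * t ^ k) = (\<Sum>k<N. \<Sum>l<N. a k * a l * (s ^ k * t ^ l))"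
      by (simp add: sum_product ac_simps)
    moreover have "\<dots> = (\<Sum>k<N. \<Sum>l<N. a k * a l * (s ^ l * t ^ k))"
      by (subst sum.swap) (simp add: ac_simps)
    ultimately show ?thesis by (simp add: distrib_left sum.distrib)
  qed
  have "0 \<le> (\<Sum>k<N. \<Sum>l<N. a k * a l * ((x ^ k * x' ^ l - x ^ l * x' ^ k) * (y ^ k * y' ^ l - y ^ l * y' ^ k)))"
    by (intro sum_nonneg mult_nonneg_nonneg[OF _ sign] mult_nonneg_nonneg a)
  also have "\<dots> = 2 * ((\<Sum>k<N. a k * (x * y) ^ k) * (\<Sum>k<N. a k * (x' * y') ^ k))
    - 2 * ((\<Sum>k<N. a k * (x * y') ^ k) * (\<Sum>k<N. a k * (x' * y) ^ k))"
    unfolding dbl sum_subtractf[symmetric]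
    by (intro sum.cong refl) (simp add: power_mult_distrib algebra_simps)
  finally show ?thesis by simp
qed

lemma hypergeom_0F1_TP2:
  assumes "\<alpha> > 0" "0 \<le> x" "x \<le> x'" "0 \<le> y" "y \<le> y'" "q \<ge> 0"
  shows "hypergeom_0F1 \<alpha> (q * x * y') * hypergeom_0F1 \<alpha> (q * x' * y)
    \<le> hypergeom_0F1 \<alpha> (q * x * y) * hypergeom_0F1 \<alpha> (q * x' * y')"
proof -
  define a where "a k = q ^ k / (pochhammer \<alpha> k * fact k)" for k
  have a: "a k \<ge> 0" for k
    using assms by (auto simp: a_def intro!: divide_nonneg_pos mult_pos_pos pochhammer_pos)
  have lim: "(\<lambda>N. \<Sum>k<N. a k * (u * v) ^ k) \<longlonglongrightarrow> hypergeom_0F1 \<alpha> (q * u * v)" for u v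
    using hypergeom_0F1_sums[OF assms(1), of "q * u * v"]
    by (simp add: sums_def a_def power_mult_distrib ac_simps)
  show ?thesis
    by (rule LIMSEQ_le[OF tendsto_mult[OF lim lim] tendsto_mult[OF lim lim]])
      (use sum_powers_TP2[OF a] assms in auto)
qed

lemma nn_integral_gamma_density:
  fixes a s :: real
  assumes "a > 0" "s > 0"
  shows "(\<integral>\<^sup>+x. ennreal (indicator {0<..} x * (x powr (a - 1) * exp (- (s * x)))) \<partial>lborel)
    = ennreal (Gamma a * s powr (- a))"
proof -
  have "ennreal (Gamma a) = (\<integral>\<^sup>+t. ennreal (indicator {0..} t * t powr (a - 1) / exp t) \<partial>lborel)"
    using Gamma_conv_nn_integral_real[OF assms(1)] by simp
  also have "\<dots> = ennreal \<bar>s\<bar> * (\<integral>\<^sup>+t. ennreal (indicator {0..} (0 + s * t) * (0 + s * t) powr (a - 1) / exp (0 + s * t)) \<partial>lborel)"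
    using assms by (intro nn_integral_real_affine) auto
  also have "\<dots> = ennreal s * (\<integral>\<^sup>+t. ennreal (s powr (a - 1)) * ennreal (indicator {0<..} t * (t powr (a - 1) * exp (- (s * t)))) \<partial>lborel)"
    using assms
    by (intro arg_cong2[of _ _ _ _ "(*)"] nn_integral_cong)
       (auto simp: powr_mult exp_minus field_simps indicator_def zero_le_mult_iff simp flip: ennreal_mult)
  also have "\<dots> = ennreal (s powr a) * (\<integral>\<^sup>+t. ennreal (indicator {0<..} t * (t powr (a - 1) * exp (- (s * t)))) \<partial>lborel)"
  proof -
    have "s * s powr (a - 1) = s powr a" using assms by (simp add: powr_mult_base)
    then have "ennreal s * ennreal (s powr (a - 1)) = ennreal (s powr a)"
      using assms by (simp flip: ennreal_mult)
    then show ?thesis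
      by (subst nn_integral_cmult) (simp_all only: mult.assoc[symmetric], measurable)
  qed
  finally have *: "ennreal (Gamma a) = ennreal (s powr a) * (\<integral>\<^sup>+t. ennreal (indicator {0<..} t * (t powr (a - 1) * exp (- (s * t)))) \<partial>lborel)" (is "_ = _ * ?I") .
  have "?I = (ennreal (s powr (- a)) * ennreal (s powr a)) * ?I"
    using assms by (simp add: powr_add[symmetric] flip: ennreal_mult)
  also have "\<dots> = ennreal (s powr (- a)) * ennreal (Gamma a)"
    by (simp add: * mult.assoc)
  finally show ?thesis
    using assms by (simp add: ennreal_mult[symmetric] mult.commute Gamma_real_nonneg)
qed

text \<open>
  Termwise integration turns the \<open>k\<close>-th coefficient into \<open>Gamma (a + k) / pochhammer a k = Gamma a\<close>,
  so that the factor \<open>(a)_k\<close> cancels and an exponential series remains.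
  This is the identity by which a leaf of the tree can be integrated out.
\<close>

lemma nn_integral_gamma_density_0F1:
  fixes a s q :: real
  assumes "a > 0" "s > 0" "q \<ge> 0"
  shows "(\<integral>\<^sup>+x. ennreal (indicator {0<..} x * (x powr (a - 1) * exp (- (s * x))) * hypergeom_0F1 a (q * x)) \<partial>lborel)
    = ennreal (Gamma a * s powr (- a) * exp (q / s))"
proof -
  let ?c = "\<lambda>k. q ^ k / (pochhammer a k * fact k)"
  have c: "?c k \<ge> 0" for k
    using assms by (auto intro!: divide_nonneg_pos mult_pos_pos pochhammer_pos)
  have Gamma_pos: "Gamma a > 0" using assms by (simp add: Gamma_real_pos)
  have "ennreal (indicator {0<..} x * (x powr (a - 1) * exp (- (s * x))) * hypergeom_0F1 a (q * x))
     = (\<Sum>k. ennreal (?c k) * ennreal (indicator {0<..} x * (x powr (a + real k - 1) * exp (- (s * x)))))" for x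
  proof (cases "x > 0")
    case True
    have "(\<lambda>k. x powr (a - 1) * exp (- (s * x)) * ((q * x) ^ k / (pochhammer a k * fact k)))
        sums (x powr (a - 1) * exp (- (s * x)) * hypergeom_0F1 a (q * x))"
      by (intro sums_mult hypergeom_0F1_sums assms)
    moreover have "x powr (a - 1) * exp (- (s * x)) * ((q * x) ^ k / (pochhammer a k * fact k)) =
       ?c k * (x powr (a + real k - 1) * exp (- (s * x)))" for k
    proof -
      have "x powr (a + real k - 1) = x powr (a - 1) * x ^ k"
        using True by (simp add: powr_add[symmetric] powr_realpow[symmetric] algebra_simps)
      then show ?thesis by (simp add: power_mult_distrib ac_simps)
    qed
    ultimately have "(\<lambda>k. ?c k * (x powr (a + real k - 1) * exp (- (s * x))))
        sums (x powr (a - 1) * exp (- (s * x)) * hypergeom_0F1 a (q * x))" by (simp only:)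
    then have "(\<Sum>k. ennreal (?c k * (x powr (a + real k - 1) * exp (- (s * x)))))
        = ennreal (x powr (a - 1) * exp (- (s * x)) * hypergeom_0F1 a (q * x))"
      by (rule suminf_ennreal_eq[rotated]) (intro mult_nonneg_nonneg c; simp)
    then show ?thesis
      using True by (simp only: ennreal_mult'[OF c]) simp
  qed simp
  then have "(\<integral>\<^sup>+x. ennreal (indicator {0<..} x * (x powr (a - 1) * exp (- (s * x))) * hypergeom_0F1 a (q * x)) \<partial>lborel)
    = (\<Sum>k. ennreal (?c k) * ennreal (Gamma (a + real k) * s powr (- (a + real k))))"
    using assms by (simp add: nn_integral_suminf nn_integral_cmult nn_integral_gamma_density)
  also have "\<dots> = (\<Sum>k. ennreal (Gamma a * s powr (- a) * ((q / s) ^ k /\<^sub>R fact k)))"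
  proof (intro suminf_cong)
    fix k
    have "Gamma (a + real k) = pochhammer a k * Gamma a"
      using assms less_imp_neq[OF Gamma_pos] by (subst pochhammer_Gamma) (auto elim: nonpos_Ints_cases)
    moreover have "s powr (- (a + real k)) = s powr (- a) / s ^ k"
      using assms by (simp add: powr_diff powr_realpow)
    moreover have "pochhammer a k > 0" using assms by (simp add: pochhammer_pos)
    ultimately have "?c k * (Gamma (a + real k) * s powr (- (a + real k))) =
       Gamma a * s powr (- a) * ((q / s) ^ k /\<^sub>R fact k)"
      using assms by (simp add: field_simps power_divide)
    then show "ennreal (?c k) * ennreal (Gamma (a + real k) * s powr (- (a + real k))) =
       ennreal (Gamma a * s powr (- a) * ((q / s) ^ k /\<^sub>R fact k))"
      using c by (simp flip: ennreal_mult')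
  qed
  also have "\<dots> = ennreal (Gamma a * s powr (- a) * exp (q / s))"
    using assms Gamma_pos by (intro suminf_ennreal_eq sums_mult exp_converges) auto
  finally show ?thesis .
qed

section \<open>Total mass of kernels with an acyclic graph\<close>

lemma graph_cycle_mono: "graph_cycle E vs \<Longrightarrow> E \<subseteq> E' \<Longrightarrow> graph_cycle E' vs"
  unfolding graph_cycle_def by blast

text \<open>
  The first vertex of a longest path is a leaf: another neighbour would either prolong the path
  or, lying on it, close a cycle.
\<close>

lemma acyclic_graph_leaf:
  fixes E :: "'n::finite set set"
  assumes acyc: "\<nexists>vs. graph_cycle E vs" and loops: "\<And>i. {i} \<notin> E"
    and edge: "{u, v} \<in> E"
  obtains i j where "i \<noteq> j" "{i, j} \<in> E" "\<And>k. {i, k} \<in> E \<Longrightarrow> k = j"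
proof -
  define path where "path vs \<longleftrightarrow> distinct vs \<and> (\<forall>k. Suc k < length vs \<longrightarrow> {vs ! k, vs ! Suc k} \<in> E)" for vs
  have uv: "path [u, v]"
    using edge loops[of u] by (auto simp: path_def)
  have "length vs \<le> CARD('n)" if "path vs" for vs
    using that card_mono[of UNIV "set vs"] by (simp add: path_def distinct_card)
  then have "\<forall>vs. path vs \<longrightarrow> length vs < Suc CARD('n)"
    by (simp add: less_Suc_eq_le)
  from ex_has_greatest_nat[OF uv this]
  obtain vs where vs: "path vs" and max: "\<And>ws. path ws \<Longrightarrow> length ws \<le> length vs"
    by blast
  from max[OF uv] obtain a b rest where ab: "vs = a # b # rest"
    by (cases vs; cases "tl vs") auto
  show ?thesis
  proof
    show "a \<noteq> b" "{a, b} \<in> E"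
      using vs ab by (auto simp: path_def dest: spec[of _ 0])
    fix k assume k: "{a, k} \<in> E"
    show "k = b"
    proof (rule ccontr)
      assume "k \<noteq> b"
      have "k \<noteq> a" using k loops[of a] by auto
      have "k \<in> set vs"
      proof (rule ccontr)
        assume "k \<notin> set vs"
        then have "path (k # vs)"
          using vs k ab by (auto simp: path_def nth_Cons insert_commute split: nat.split)
        from max[OF this] show False by simp
      qed
      then obtain m where m: "m < length vs" "vs ! m = k" by (auto simp: in_set_conv_nth)
      have m2: "m \<ge> 2"
        using \<open>k \<noteq> a\<close> \<open>k \<noteq> b\<close> m ab by (cases m; cases "m - 1") auto
      have "graph_cycle E (take (Suc m) vs)"
        unfolding graph_cycle_def
      proof (intro conjI allI impI)
        show "3 \<le> length (take (Suc m) vs)" using m m2 by simp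
        show "distinct (take (Suc m) vs)" using vs by (simp add: path_def)
        fix l assume l: "l < length (take (Suc m) vs)"
        have len: "length (take (Suc m) vs) = Suc m" using m by simp
        show "{take (Suc m) vs ! l, take (Suc m) vs ! (Suc l mod length (take (Suc m) vs))} \<in> E"
        proof (cases "l = m")
          case True
          moreover have "take (Suc m) vs ! m = k" "take (Suc m) vs ! 0 = a"
            using m ab by (simp_all only: nth_take lessI zero_less_Suc nth_Cons_0)
          ultimately show ?thesis using k by (simp only: True len mod_self insert_commute)
        next
          case False
          then show ?thesis using l m vs by (simp add: len path_def)
        qed
      qed
      with acyc show False by blast
    qed
  qed
qed

definition pos_def_sym :: "real ^ 'n ^ 'n \<Rightarrow> bool" where
  "pos_def_sym A \<longleftrightarrow> transpose A = A \<and> (\<forall>v. v \<noteq> 0 \<longrightarrow> 0 < v \<bullet> (A *v v))"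

lemma pos_def_sym_diag:
  assumes "pos_def_sym (A :: real ^ 'n ^ 'n)"
  shows "0 < A $ i $ i"
proof -
  have "axis i (1::real) \<noteq> (0 :: real ^ 'n)" by (simp add: axis_eq_0_iff)
  then have "0 < axis i 1 \<bullet> (A *v axis i 1)" using assms unfolding pos_def_sym_def by blast
  also have "\<dots> = A $ i $ i" by (simp add: inner_axis' matrix_vector_mult_basis column_def)
  finally show ?thesis .
qed

lemma transpose_nth: "transpose A = A \<Longrightarrow> A $ i $ j = A $ j $ i"
  by (metis transpose_def vec_lambda_beta)

lemma pos_def_sym_congruence:
  fixes A E :: "real ^ 'n ^ 'n"
  assumes A: "pos_def_sym A" and E: "det E \<noteq> 0"
  shows "pos_def_sym (E ** A ** transpose E)"
  unfolding pos_def_sym_def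
proof (intro conjI allI impI)
  show "transpose (E ** A ** transpose E) = E ** A ** transpose E"
    using A by (simp add: matrix_transpose_mul pos_def_sym_def matrix_mul_assoc)
  fix v :: "real ^ 'n" assume "v \<noteq> 0"
  have "invertible (transpose E)"
    using E by (simp add: invertible_det_nz det_transpose)
  then have "transpose E *v v \<noteq> 0"
    using \<open>v \<noteq> 0\<close> by (metis invertible_def matrix_vector_mul_assoc matrix_vector_mul_lid matrix_vector_mult_0_right)
  then have "0 < (transpose E *v v) \<bullet> (A *v (transpose E *v v))"
    using A by (simp add: pos_def_sym_def)
  also have "\<dots> = v \<bullet> (E *v (A *v (transpose E *v v)))"
    by (metis dot_lmul_matrix vector_transpose_matrix transpose_transpose)
  finally show "0 < v \<bullet> ((E ** A ** transpose E) *v v)"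
    by (simp only: matrix_vector_mul_assoc matrix_mul_assoc)
qed

text \<open>
  One step of symmetric Gaussian elimination with the pivot at the leaf \<open>i\<close>. The congruence
  by a transvection keeps the determinant and positive definiteness; it deletes the edge to \<open>j\<close>
  and otherwise changes only the diagonal entry of \<open>j\<close>, since row \<open>i\<close> has no further entries.
  The index type stays the same, so the procedure can be iterated.
\<close>

lemma eliminate_leaf:
  fixes A :: "real ^ 'n ^ 'n"
  assumes A: "pos_def_sym A" and "i \<noteq> j"
    and leaf: "\<And>k. k \<noteq> i \<Longrightarrow> k \<noteq> j \<Longrightarrow> A $ i $ k = 0"
  obtains B where "pos_def_sym B" "det B = det A"
    "\<And>k l. B $ k $ l = (if k = j \<and> l = j then A $ j $ j - (A $ i $ j)\<^sup>2 / A $ i $ i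
       else if k \<noteq> l \<and> (k = i \<or> l = i) then 0 else A $ k $ l)"
proof -
  have sym: "A $ k $ l = A $ l $ k" for k l
    using A by (auto simp: pos_def_sym_def intro: transpose_nth)
  have Aii: "A $ i $ i > 0" using pos_def_sym_diag[OF A] .
  define c where "c = - A $ i $ j / A $ i $ i"
  define E :: "real ^ 'n ^ 'n" where "E = (\<chi> k l. if k = l then 1 else if k = j \<and> l = i then c else 0)"
  have left: "(E ** X) $ k $ l = X $ k $ l + (if k = j then c * X $ i $ l else 0)" for X :: "real ^ 'n ^ 'n" and k l
  proof -
    have "(E ** X) $ k $ l = (\<Sum>m\<in>UNIV. E $ k $ m * X $ m $ l)"
      by (simp add: matrix_matrix_mult_def)
    also have "\<dots> = (\<Sum>m\<in>UNIV. (if m = k then X $ m $ l else 0) + (if m = i then (if k = j then c * X $ i $ l else 0) else 0))"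
      using \<open>i \<noteq> j\<close> by (intro sum.cong refl) (auto simp: E_def)
    finally show ?thesis by (simp add: sum.distrib)
  qed
  have right: "(X ** transpose E) $ k $ l = X $ k $ l + (if l = j then c * X $ k $ i else 0)" for X :: "real ^ 'n ^ 'n" and k l
  proof -
    have "(X ** transpose E) $ k $ l = (\<Sum>m\<in>UNIV. X $ k $ m * E $ l $ m)"
      by (simp add: matrix_matrix_mult_def transpose_def)
    also have "\<dots> = (\<Sum>m\<in>UNIV. (if m = l then X $ k $ m else 0) + (if m = i then (if l = j then c * X $ k $ i else 0) else 0))"
      using \<open>i \<noteq> j\<close> by (intro sum.cong refl) (auto simp: E_def)
    finally show ?thesis by (simp add: sum.distrib)
  qed
  have "E = (\<chi> k. if k = j then row j (mat 1) + c *s row i (mat 1) else row k (mat 1))"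
    using \<open>i \<noteq> j\<close> by (auto simp: E_def vec_eq_iff row_def mat_def)
  then have detE: "det E = 1"
    using det_row_operation[of j i "mat 1" c] \<open>i \<noteq> j\<close> by simp
  show ?thesis
  proof
    show "pos_def_sym (E ** A ** transpose E)"
      using A detE by (intro pos_def_sym_congruence) auto
    show "det (E ** A ** transpose E) = det A"
      by (simp add: det_mul det_transpose detE)
    show "(E ** A ** transpose E) $ k $ l = (if k = j \<and> l = j then A $ j $ j - (A $ i $ j)\<^sup>2 / A $ i $ i
       else if k \<noteq> l \<and> (k = i \<or> l = i) then 0 else A $ k $ l)" for k l
    proof -
      have cA: "c * A $ i $ i = - A $ i $ j" using Aii by (simp add: c_def)
      have jj: "c * A $ i $ j = - ((A $ i $ j)\<^sup>2 / A $ i $ i)" by (simp add: c_def power2_eq_square)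
      have leaf': "A $ m $ i = 0" if "m \<noteq> i" "m \<noteq> j" for m
        using leaf[OF that] sym[of m i] by simp
      have ji: "A $ j $ i = A $ i $ j" by (rule sym)
      show ?thesis
        unfolding left right using \<open>i \<noteq> j\<close>
        by (auto simp: cA jj ji leaf leaf' distrib_left)
    qed
  qed
qed

text \<open>
  The unnormalised density, extended by zero outside the positive orthant, for an arbitrary matrix
  in the role of the inverse. It takes plain functions as arguments so that Fubini's theorem for
  \<open>PiM\<close> applies coordinate by coordinate.
\<close>

definition orthant_kernel :: "real \<Rightarrow> real ^ 'n::{finite, linorder} ^ 'n::{finite, linorder} \<Rightarrow> ('n \<Rightarrow> real) \<Rightarrow> real" where
  "orthant_kernel \<alpha> A x =
     (\<Prod>i\<in>UNIV. indicator {0<..} (x i) * (x i powr (\<alpha> - 1) * exp (- (A $ i $ i * x i)))) *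
     (\<Prod>(i, j)\<in>{(i, j). i < j}. hypergeom_0F1 \<alpha> ((A $ i $ j)\<^sup>2 * x i * x j))"

lemma borel_measurable_orthant_kernel [measurable]:
  "orthant_kernel \<alpha> A \<in> borel_measurable (\<Pi>\<^sub>M i\<in>UNIV. lborel)"
  unfolding orthant_kernel_def[abs_def]
  by (intro borel_measurable_times borel_measurable_prod) (auto simp: split_beta)

lemma nn_integral_PiM_cong_coordinate:
  fixes f g :: "('i::finite \<Rightarrow> 'a) \<Rightarrow> ennreal"
  assumes sf: "\<And>i. sigma_finite_measure (M i)"
    and [measurable]: "f \<in> borel_measurable (PiM UNIV M)" "g \<in> borel_measurable (PiM UNIV M)"
    and eq: "\<And>x. (\<integral>\<^sup>+y. f (x(i := y)) \<partial>M i) = (\<integral>\<^sup>+y. g (x(i := y)) \<partial>M i)"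
  shows "(\<integral>\<^sup>+x. f x \<partial>PiM UNIV M) = (\<integral>\<^sup>+x. g x \<partial>PiM UNIV M)"
proof -
  interpret product_sigma_finite M by (simp add: product_sigma_finite_def sf)
  have U: "UNIV = insert i (UNIV - {i})" by auto
  have "(\<integral>\<^sup>+x. h x \<partial>PiM UNIV M) = (\<integral>\<^sup>+x. \<integral>\<^sup>+y. h (x(i := y)) \<partial>M i \<partial>PiM (UNIV - {i}) M)"
    if "h \<in> borel_measurable (PiM UNIV M)" for h :: "('i \<Rightarrow> 'a) \<Rightarrow> ennreal"
    using product_nn_integral_insert[of "UNIV - {i}" i h] that by (simp add: insert_UNIV)
  then show ?thesis by (simp add: eq)
qed

text \<open>
  Up to a constant, integration over \<open>x i\<close> yields the factor \<open>exp (q * x j / s)\<close>, where \<open>q = (A $ i $ j)\<^sup>2\<close>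
  and \<open>s = A $ i $ i\<close>. It is exactly the change of \<open>exp (- A $ j $ j * x j)\<close> when the diagonal
  entry of \<open>j\<close> is replaced by its Schur complement. Hence both kernels agree after integrating
  over the single coordinate \<open>x i\<close>.
\<close>

lemma nn_integral_orthant_kernel_eliminate:
  fixes A B :: "real ^ 'n::{finite, linorder} ^ 'n::{finite, linorder}"
  assumes "\<alpha> > 0" "i \<noteq> j" "A $ i $ i > 0" and sym: "A $ j $ i = A $ i $ j"
    and leaf: "\<And>k. k \<noteq> i \<Longrightarrow> k \<noteq> j \<Longrightarrow> A $ i $ k = 0 \<and> A $ k $ i = 0"
    and B: "\<And>k l. B $ k $ l = (if k = j \<and> l = j then A $ j $ j - (A $ i $ j)\<^sup>2 / A $ i $ i
       else if k \<noteq> l \<and> (k = i \<or> l = i) then 0 else A $ k $ l)"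
  shows "(\<integral>\<^sup>+x. ennreal (orthant_kernel \<alpha> A x) \<partial>(\<Pi>\<^sub>M i\<in>UNIV. lborel))
    = (\<integral>\<^sup>+x. ennreal (orthant_kernel \<alpha> B x) \<partial>(\<Pi>\<^sub>M i\<in>UNIV. lborel))"
proof (rule nn_integral_PiM_cong_coordinate[of _ _ _ i])
  fix x :: "'n \<Rightarrow> real"
  define q s where "q = (A $ i $ j)\<^sup>2" and "s = A $ i $ i"
  define g where "g X x k = indicator {0<..} (x k) * (x k powr (\<alpha> - 1) * exp (- (X $ k $ k * x k)))"
    for X and x :: "'n \<Rightarrow> real" and k
  define G where "G X x = (\<lambda>(k, l). hypergeom_0F1 \<alpha> ((X $ k $ l)\<^sup>2 * x k * x l))"
    for X and x :: "'n \<Rightarrow> real"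
  define P where "P = {(k, l :: 'n). k < l}"
  \<comment> \<open>\<open>p\<close> is the only pair containing \<open>i\<close> whose factor can differ from 1; the remaining factors do not depend on \<open>x i\<close>.\<close>
  define p where "p = (min i j, max i j)"
  have p: "p \<in> P" using \<open>i \<noteq> j\<close> by (auto simp: p_def P_def min_def max_def)
  have split: "orthant_kernel \<alpha> X x = g X x i * g X x j * (\<Prod>k\<in>UNIV - {i} - {j}. g X x k) * (G X x p * (\<Prod>r\<in>P - {p}. G X x r))" for X x
  proof -
    have "orthant_kernel \<alpha> X x = (\<Prod>k\<in>UNIV. g X x k) * (\<Prod>r\<in>P. G X x r)"
      by (simp add: orthant_kernel_def g_def G_def P_def)
    also have "(\<Prod>k\<in>UNIV. g X x k) = g X x i * g X x j * (\<Prod>k\<in>UNIV - {i} - {j}. g X x k)"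
      using \<open>i \<noteq> j\<close> by (simp add: prod.remove[of UNIV i] prod.remove[of "UNIV - {i}" j])
    also have "(\<Prod>r\<in>P. G X x r) = G X x p * (\<Prod>r\<in>P - {p}. G X x r)"
      using p by (simp add: prod.remove)
    finally show ?thesis .
  qed
  define rest where "rest = (\<Prod>k\<in>UNIV - {i} - {j}. g A x k) * (\<Prod>r\<in>P - {p}. G A x r)"
  define h where "h y = indicator {0<..} y * (y powr (\<alpha> - 1) * exp (- (s * y)))" for y
  have G_rest: "G X (x(i := y)) r = G A x r" if X: "X = A \<or> X = B" and r: "r \<in> P - {p}" for X y r
  proof -
    obtain k l where kl: "r = (k, l)" "k < l" using r by (auto simp: P_def)
    have "(k = i \<or> l = i) \<Longrightarrow> A $ k $ l = 0"
      using r leaf[of l] leaf[of k] kl by (auto simp: p_def min_def max_def split: if_splits)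
    then show ?thesis using X kl B[of k l] by (auto simp: G_def)
  qed
  have g_rest: "g X (x(i := y)) k = g A x k" if "X = A \<or> X = B" "k \<in> UNIV - {i} - {j}" for X y k
    using that B[of k k] by (auto simp: g_def)
  have rest: "(\<Prod>k\<in>UNIV - {i} - {j}. g X (x(i := y)) k) * (\<Prod>r\<in>P - {p}. G X (x(i := y)) r) = rest"
    if "X = A \<or> X = B" for X y
    unfolding rest_def using that by (intro arg_cong2[of _ _ _ _ "(*)"] prod.cong refl g_rest G_rest)
  have KA: "orthant_kernel \<alpha> A (x(i := y)) = h y * hypergeom_0F1 \<alpha> (q * x j * y) * (g A x j * rest)" for y
  proof -
    have "G A (x(i := y)) p = hypergeom_0F1 \<alpha> (q * x j * y)"
      using \<open>i \<noteq> j\<close> sym by (auto simp: G_def p_def min_def max_def q_def ac_simps)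
    moreover have "g A (x(i := y)) i = h y" "g A (x(i := y)) j = g A x j"
      using \<open>i \<noteq> j\<close> by (auto simp: g_def h_def s_def)
    ultimately show ?thesis
      unfolding split using rest[of A y] by (simp add: ac_simps)
  qed
  have KB: "orthant_kernel \<alpha> B (x(i := y)) = h y * (exp (q * x j / s) * (g A x j * rest))" for y
  proof -
    have "G B (x(i := y)) p = 1"
      using \<open>i \<noteq> j\<close> B by (auto simp: G_def p_def min_def max_def)
    moreover have "g B (x(i := y)) i = h y"
      using \<open>i \<noteq> j\<close> B by (auto simp: g_def h_def s_def)
    moreover have "g B (x(i := y)) j = exp (q * x j / s) * g A x j"
      using \<open>i \<noteq> j\<close> B by (auto simp: g_def q_def s_def exp_add[symmetric] algebra_simps)
    ultimately show ?thesis
      unfolding split using rest[of B y] by (simp add: ac_simps)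
  qed
  show "(\<integral>\<^sup>+y. ennreal (orthant_kernel \<alpha> A (x(i := y))) \<partial>lborel)
    = (\<integral>\<^sup>+y. ennreal (orthant_kernel \<alpha> B (x(i := y))) \<partial>lborel)"
  proof (cases "(\<forall>k. k \<noteq> i \<longrightarrow> x k > 0)")
    case False
    then obtain k where k: "k \<noteq> i" "\<not> 0 < x k" by blast
    then have "g A x k = 0" by (simp add: g_def)
    have zero: "g A x j * rest = 0"
    proof (cases "k = j")
      case True
      with \<open>g A x k = 0\<close> show ?thesis by simp
    next
      case False
      then have "(\<Prod>k\<in>UNIV - {i} - {j}. g A x k) = 0"
        using k \<open>g A x k = 0\<close> by (intro prod_zero) auto
      then show ?thesis by (simp only: rest_def mult_zero_left mult_zero_right)
    qed
    show ?thesis by (simp only: KA KB zero mult_zero_right)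
  next
    case True
    then have "x j > 0" using \<open>i \<noteq> j\<close> by simp
    then have xj: "q * x j \<ge> 0" by (simp add: q_def)
    have s: "s > 0" using assms by (simp add: s_def)
    have C: "g A x j * rest \<ge> 0"
    proof -
      have "G A x r \<ge> 0" if "r \<in> P - {p}" for r
      proof -
        obtain k l where kl: "r = (k, l)" by (cases r)
        have "(A $ k $ l)\<^sup>2 * x k * x l \<ge> 0"
        proof (cases "k = i \<or> l = i")
          case True
          then have "A $ k $ l = 0"
            using that leaf[of l] leaf[of k] kl by (auto simp: p_def P_def min_def max_def split: if_splits)
          then show ?thesis by simp
        next
          case False
          then show ?thesis using True by (intro mult_nonneg_nonneg) (auto intro: less_imp_le)
        qed
        then show ?thesis using hypergeom_0F1_ge_1[OF \<open>\<alpha> > 0\<close>] kl by (auto simp: G_def intro: order_trans[OF zero_le_one])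
      qed
      then show ?thesis unfolding rest_def by (intro mult_nonneg_nonneg prod_nonneg) (auto simp: g_def)
    qed
    have [measurable]: "h \<in> borel_measurable borel" unfolding h_def by measurable
    have "(\<integral>\<^sup>+y. ennreal (orthant_kernel \<alpha> A (x(i := y))) \<partial>lborel) =
      (\<integral>\<^sup>+y. ennreal (h y * hypergeom_0F1 \<alpha> (q * x j * y)) * ennreal (g A x j * rest) \<partial>lborel)"
      by (simp only: KA ennreal_mult''[OF C])
    also have "\<dots> = ennreal (Gamma \<alpha> * s powr (- \<alpha>) * exp (q * x j / s)) * ennreal (g A x j * rest)"
      using nn_integral_gamma_density_0F1[OF \<open>\<alpha> > 0\<close> s xj] by (simp add: nn_integral_multc h_def)
    also have "\<dots> = ennreal (Gamma \<alpha> * s powr (- \<alpha>)) * ennreal (exp (q * x j / s) * (g A x j * rest))"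
      using C by (simp add: mult.assoc flip: ennreal_mult'')
    also have "\<dots> = (\<integral>\<^sup>+y. ennreal (h y) * ennreal (exp (q * x j / s) * (g A x j * rest)) \<partial>lborel)"
      using nn_integral_gamma_density[OF \<open>\<alpha> > 0\<close> s] by (simp add: nn_integral_multc h_def)
    also have "\<dots> = (\<integral>\<^sup>+y. ennreal (orthant_kernel \<alpha> B (x(i := y))) \<partial>lborel)"
      using C by (subst ennreal_mult''[symmetric]) (simp_all add: KB)
    finally show ?thesis .
  qed
qed (auto intro: sigma_finite_lborel)

text \<open>
  Induction on the number of edges. Every edge deletion leaves the integral and the determinant
  unchanged, and for a diagonal matrix the integral is a product of gamma integrals.
  Positivity of the determinant comes out of the same elimination.
\<close>

lemma nn_integral_orthant_kernel:
  fixes A :: "real ^ 'n::{finite, linorder} ^ 'n::{finite, linorder}"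
  assumes "\<alpha> > 0" "pos_def_sym A" "\<nexists>vs. graph_cycle (matrix_graph_edges A) vs"
  shows "0 < det A \<and> (\<integral>\<^sup>+x. ennreal (orthant_kernel \<alpha> A x) \<partial>(\<Pi>\<^sub>M i\<in>UNIV. lborel))
    = ennreal (Gamma \<alpha> ^ CARD('n) * det A powr (- \<alpha>))"
  using assms(2,3)
proof (induction "card (matrix_graph_edges A)" arbitrary: A rule: less_induct)
  case less
  have sym: "A $ k $ l = A $ l $ k" for k l
    using less.prems by (auto simp: pos_def_sym_def intro: transpose_nth)
  note diag = pos_def_sym_diag[OF less.prems(1)]
  show ?case
  proof (cases "matrix_graph_edges A = {}")
    case True
    then have off: "A $ k $ l = 0" if "k \<noteq> l" for k l
      using that by (auto simp: matrix_graph_edges_def)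
    then have det: "det A = (\<Prod>i\<in>UNIV. A $ i $ i)" by (intro det_diagonal)
    interpret product_sigma_finite "\<lambda>_::'n. lborel :: real measure"
      by (simp add: product_sigma_finite_def sigma_finite_lborel)
    have "(\<integral>\<^sup>+x. ennreal (orthant_kernel \<alpha> A x) \<partial>(\<Pi>\<^sub>M i\<in>UNIV. lborel))
      = (\<integral>\<^sup>+x. (\<Prod>i\<in>UNIV. ennreal (indicator {0<..} (x i) * (x i powr (\<alpha> - 1) * exp (- (A $ i $ i * x i))))) \<partial>(\<Pi>\<^sub>M i\<in>UNIV. lborel))"
    proof (intro nn_integral_cong)
      fix x :: "'n \<Rightarrow> real"
      have "(\<Prod>(i, j)\<in>{(i, j). i < j}. hypergeom_0F1 \<alpha> ((A $ i $ j)\<^sup>2 * x i * x j)) = 1"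
        using off by (intro prod.neutral) auto
      then show "ennreal (orthant_kernel \<alpha> A x) = (\<Prod>i\<in>UNIV. ennreal (indicator {0<..} (x i) * (x i powr (\<alpha> - 1) * exp (- (A $ i $ i * x i)))))"
        by (subst prod_ennreal) (simp_all add: orthant_kernel_def)
    qed
    also have "\<dots> = (\<Prod>i\<in>UNIV. ennreal (Gamma \<alpha> * (A $ i $ i) powr (- \<alpha>)))"
      using diag \<open>\<alpha> > 0\<close>
      by (subst product_nn_integral_prod) (simp_all add: nn_integral_gamma_density)
    also have "\<dots> = ennreal (Gamma \<alpha> ^ CARD('n) * det A powr (- \<alpha>))"
      using diag \<open>\<alpha> > 0\<close>
      by (subst prod_ennreal) (auto simp: prod.distrib det prod_powr_distrib less_imp_le Gamma_real_nonneg)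
    finally show ?thesis using diag det by (simp add: prod_pos)
  next
    case False
    then obtain u v where "{u, v} \<in> matrix_graph_edges A" by (auto simp: matrix_graph_edges_def)
    moreover have "{k} \<notin> matrix_graph_edges A" for k
      by (auto simp: matrix_graph_edges_def doubleton_eq_iff)
    ultimately obtain i j where ij: "i \<noteq> j" "{i, j} \<in> matrix_graph_edges A"
      and leaf: "\<And>k. {i, k} \<in> matrix_graph_edges A \<Longrightarrow> k = j"
      using acyclic_graph_leaf[OF less.prems(2)] by metis
    have edge_iff: "{k, l} \<in> matrix_graph_edges A \<longleftrightarrow> A $ k $ l \<noteq> 0" if "k \<noteq> l" for k l
      using that sym[of k l] by (auto simp: matrix_graph_edges_def doubleton_eq_iff)
    have leaf0: "A $ i $ k = 0" if "k \<noteq> i" "k \<noteq> j" for k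
      using that leaf[of k] edge_iff[of i k] by auto
    obtain B where B: "pos_def_sym B" "det B = det A"
      and entries: "\<And>k l. B $ k $ l = (if k = j \<and> l = j then A $ j $ j - (A $ i $ j)\<^sup>2 / A $ i $ i
       else if k \<noteq> l \<and> (k = i \<or> l = i) then 0 else A $ k $ l)"
      using eliminate_leaf[OF less.prems(1) ij(1) leaf0] by blast
    have sub: "matrix_graph_edges B \<subseteq> matrix_graph_edges A"
    proof
      fix e assume "e \<in> matrix_graph_edges B"
      then obtain k l where e: "e = {k, l}" "k \<noteq> l" "B $ k $ l \<noteq> 0"
        by (auto simp: matrix_graph_edges_def)
      then have "A $ k $ l \<noteq> 0" using entries[of k l] by (auto split: if_splits)
      with e show "e \<in> matrix_graph_edges A" by (auto simp: matrix_graph_edges_def)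
    qed
    have "B $ i $ j = 0" "B $ j $ i = 0" using entries[of i j] entries[of j i] ij(1) by simp_all
    then have "{i, j} \<notin> matrix_graph_edges B"
      by (auto simp: matrix_graph_edges_def doubleton_eq_iff)
    with sub ij have "card (matrix_graph_edges B) < card (matrix_graph_edges A)"
      by (intro psubset_card_mono) auto
    moreover have "\<nexists>vs. graph_cycle (matrix_graph_edges B) vs"
      using less.prems(2) graph_cycle_mono[OF _ sub] by blast
    ultimately have "0 < det B \<and> (\<integral>\<^sup>+x. ennreal (orthant_kernel \<alpha> B x) \<partial>(\<Pi>\<^sub>M i\<in>UNIV. lborel))
      = ennreal (Gamma \<alpha> ^ CARD('n) * det B powr (- \<alpha>))"
      using less.hyps B(1) by blast
    moreover have "(\<integral>\<^sup>+x. ennreal (orthant_kernel \<alpha> A x) \<partial>(\<Pi>\<^sub>M i\<in>UNIV. lborel))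
      = (\<integral>\<^sup>+x. ennreal (orthant_kernel \<alpha> B x) \<partial>(\<Pi>\<^sub>M i\<in>UNIV. lborel))"
    proof (rule nn_integral_orthant_kernel_eliminate[OF \<open>\<alpha> > 0\<close> ij(1) diag sym _ entries])
      show "A $ i $ k = 0 \<and> A $ k $ i = 0" if "k \<noteq> i" "k \<noteq> j" for k
        using leaf0[OF that] sym[of k i] by simp
    qed
    ultimately show ?thesis using B(2) by simp
  qed
qed

section \<open>Uniqueness of multivariate Laplace transforms\<close>

text \<open>
  Closure under products is proved rather than built in: with monomials and sums as the only
  generators, equality of integrals extends from monomials by a direct induction.
\<close>

inductive_set vec_polynomials :: "(real ^ 'n \<Rightarrow> real) set" where
  monomial: "(\<lambda>y. c * (\<Prod>i\<in>UNIV. (y $ i) ^ k i)) \<in> vec_polynomials"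
| add: "f \<in> vec_polynomials \<Longrightarrow> g \<in> vec_polynomials \<Longrightarrow> (\<lambda>y. f y + g y) \<in> vec_polynomials"

lemma vec_polynomials_mult:
  assumes "f \<in> vec_polynomials" "g \<in> vec_polynomials"
  shows "(\<lambda>y. f y * g y) \<in> vec_polynomials"
  using assms(1)
proof induction
  case (monomial c k)
  show ?case using assms(2)
  proof induction
    case (monomial d l)
    have "(\<lambda>y. c * (\<Prod>i\<in>UNIV. (y $ i) ^ k i) * (d * (\<Prod>i\<in>UNIV. (y $ i) ^ l i)))
      = (\<lambda>y. (c * d) * (\<Prod>i\<in>UNIV. (y $ i) ^ (k i + l i)))"
      by (simp add: power_add prod.distrib fun_eq_iff)
    then show ?case by (simp only: vec_polynomials.monomial)
  next
    case (add f g)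
    then show ?case by (simp add: distrib_left vec_polynomials.add)
  qed
next
  case (add f g)
  then show ?case by (simp add: distrib_right vec_polynomials.add)
qed

lemma continuous_on_vec_polynomials: "f \<in> vec_polynomials \<Longrightarrow> continuous_on S f"
  by (induction rule: vec_polynomials.induct) (auto intro!: continuous_intros)

lemma function_ring_on_vec_polynomials:
  "compact S \<Longrightarrow> function_ring_on vec_polynomials S"
proof
  fix x y :: "real ^ 'n" assume "x \<noteq> y"
  then obtain j where j: "x $ j \<noteq> y $ j" by (auto simp: vec_eq_iff)
  have "(\<lambda>y. 1 * (\<Prod>i\<in>UNIV. (y $ i) ^ (if i = j then 1 else 0))) \<in> vec_polynomials"
    by (rule vec_polynomials.monomial)
  moreover have "(\<Prod>i\<in>UNIV. (y $ i) ^ (if i = j then 1 else 0)) = y $ j" for y :: "real ^ 'n"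
    by (subst prod.remove[of _ j]) auto
  ultimately have "(\<lambda>y. y $ j) \<in> vec_polynomials" by simp
  with j show "\<exists>f\<in>vec_polynomials. f x \<noteq> f y" by (intro bexI[of _ "\<lambda>y. y $ j"])
next
  fix c
  show "(\<lambda>_. c) \<in> vec_polynomials" using vec_polynomials.monomial[of c "\<lambda>_. 0"] by simp
qed (auto intro: vec_polynomials_mult vec_polynomials.add continuous_on_vec_polynomials)

lemma integrable_continuous_compact:
  fixes f :: "'a::euclidean_space \<Rightarrow> real"
  assumes "finite_measure M" and [measurable_cong]: "sets M = sets borel"
    and "AE y in M. y \<in> S" "compact S" and f: "continuous_on UNIV f"
  shows "integrable M f"
proof -
  have "compact (f ` S)"
    using assms f by (intro compact_continuous_image) (auto intro: continuous_on_subset)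
  then obtain B where B: "\<And>y. y \<in> S \<Longrightarrow> norm (f y) \<le> B"
    by (meson bounded_iff compact_imp_bounded imageI)
  show ?thesis
  proof (rule finite_measure.integrable_const_bound[OF assms(1)])
    show "AE y in M. norm (f y) \<le> B" using assms(3) B by auto
    show "f \<in> borel_measurable M"
      using borel_measurable_continuous_onI[OF f] assms(2) by (simp cong: measurable_cong_sets)
  qed
qed

text \<open>
  By the Stone-Weierstrass theorem, equal moments give equal integrals of continuous functions;
  the functions \<open>min 1 (n * infdist y (- U))\<close> increase to the indicator of an open set \<open>U\<close>, and the
  open sets generate the Borel sets.
\<close>

lemma measure_eq_of_moments:
  fixes M N :: "(real ^ 'n) measure"
  assumes M: "prob_space M" "sets M = sets borel" "AE y in M. y \<in> S"
    and N: "prob_space N" "sets N = sets borel" "AE y in N. y \<in> S"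
    and S: "compact S"
    and mom: "\<And>k. (\<integral>y. (\<Prod>i\<in>UNIV. (y $ i) ^ k i) \<partial>M) = (\<integral>y. (\<Prod>i\<in>UNIV. (y $ i) ^ k i) \<partial>N)"
  shows "M = N"
proof -
  interpret M: prob_space M by fact
  interpret N: prob_space N by fact
  interpret function_ring_on vec_polynomials S
    using S by (rule function_ring_on_vec_polynomials)
  note sets [measurable_cong] = M(2) N(2)
  have int: "integrable M f \<and> integrable N f" if "continuous_on UNIV f" for f :: "real ^ 'n \<Rightarrow> real"
    using integrable_continuous_compact[OF _ _ _ S that] M N
    by (simp add: M.finite_measure_axioms N.finite_measure_axioms)
  have poly: "integral\<^sup>L M f = integral\<^sup>L N f" if "f \<in> vec_polynomials" for f
    using that
  proof induction
    case (monomial c k)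
    then show ?case by (simp add: mom)
  next
    case (add f g)
    then show ?case
      using int[OF continuous_on_vec_polynomials] by (simp add: Bochner_Integration.integral_add)
  qed
  have cont: "integral\<^sup>L M f = integral\<^sup>L N f" if f: "continuous_on UNIV f" for f :: "real ^ 'n \<Rightarrow> real"
  proof -
    have "\<bar>integral\<^sup>L M f - integral\<^sup>L N f\<bar> \<le> e" if "e > 0" for e
    proof -
      obtain g where g: "g \<in> vec_polynomials" "\<And>x. x \<in> S \<Longrightarrow> \<bar>f x - g x\<bar> < e / 2"
        using Stone_Weierstrass_basic[of f "e / 2"] \<open>e > 0\<close> continuous_on_subset[OF f] by auto
      have close: "\<bar>integral\<^sup>L K f - integral\<^sup>L K g\<bar> \<le> e / 2"
        if K: "prob_space K" "integrable K f" "integrable K g" "AE y in K. y \<in> S" for K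
      proof -
        have "\<bar>integral\<^sup>L K f - integral\<^sup>L K g\<bar> = \<bar>\<integral>x. f x - g x \<partial>K\<bar>"
          using K by simp
        also have "\<dots> \<le> (\<integral>x. \<bar>f x - g x\<bar> \<partial>K)" by (rule integral_abs_bound)
        also have "\<dots> \<le> (\<integral>x. e / 2 \<partial>K)"
          using K g by (intro integral_mono_AE) (auto simp: prob_space_def finite_measure.integrable_const less_imp_le)
        also have "\<dots> = e / 2" using K by (simp add: prob_space.prob_space)
        finally show ?thesis .
      qed
      have "integrable M g \<and> integrable N g" using int continuous_on_vec_polynomials g(1) by blast
      then have "\<bar>integral\<^sup>L M f - integral\<^sup>L M g\<bar> \<le> e / 2" "\<bar>integral\<^sup>L N f - integral\<^sup>L N g\<bar> \<le> e / 2"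
        using int[OF f] M N close[of M] close[of N] by blast+
      then show ?thesis using poly[OF g(1)] by linarith
    qed
    then have "\<bar>integral\<^sup>L M f - integral\<^sup>L N f\<bar> \<le> 0" by (rule field_le_epsilon) simp
    then show ?thesis by simp
  qed
  have op: "measure M U = measure N U" if U: "open U" for U
  proof (cases "U = UNIV")
    case True
    then show ?thesis using M.prob_space N.prob_space sets_eq_imp_space_eq[OF M(2)] sets_eq_imp_space_eq[OF N(2)] by simp
  next
    case False
    \<comment> \<open>\<open>infdist\<close> to the empty set is 0, so \<open>U = UNIV\<close> is treated separately.\<close>
    define h where "h n y = min 1 (real n * infdist y (- U))" for n :: nat and y
    have h_cont: "continuous_on UNIV (h n)" for n
      unfolding h_def by (intro continuous_intros)
    have h_lim: "(\<lambda>n. h n y) \<longlonglongrightarrow> indicator U y" for y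
    proof (cases "y \<in> U")
      case True
      then have pos: "infdist y (- U) > 0"
        using U False by (intro infdist_pos_not_in_closed) auto
      obtain n0 where n0: "1 < real n0 * infdist y (- U)"
        using reals_Archimedean3[OF pos] by blast
      have "h n y = 1" if "n \<ge> n0" for n
      proof -
        have "real n0 * infdist y (- U) \<le> real n * infdist y (- U)"
          using that pos by (intro mult_right_mono) auto
        with n0 show ?thesis by (simp add: h_def)
      qed
      then show ?thesis
        using True by (intro tendsto_eventually) (auto simp: eventually_sequentially)
    next
      case False
      then show ?thesis by (simp add: h_def)
    qed
    have "(\<lambda>n. integral\<^sup>L K (h n)) \<longlonglongrightarrow> measure K U"
      if K: "prob_space K" and [measurable_cong]: "sets K = sets borel" for K
    proof -
      have [measurable]: "U \<in> sets borel" using U by simp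
      have [measurable]: "h n \<in> borel_measurable borel" for n
        using h_cont by (rule borel_measurable_continuous_onI)
      have "(\<lambda>n. integral\<^sup>L K (h n)) \<longlonglongrightarrow> (\<integral>y. indicator U y \<partial>K)"
      proof (rule integral_dominated_convergence[where w="\<lambda>_. 1"])
        show "AE y in K. norm (h n y) \<le> 1" for n
          by (auto simp: h_def infdist_nonneg)
      qed (use h_lim K in \<open>auto simp: prob_space_def finite_measure.integrable_const\<close>)
      then show ?thesis using sets_eq_imp_space_eq[OF that(2)] by simp
    qed
    from this[OF M(1,2)] this[OF N(1,2)] show ?thesis
      using cont[OF h_cont] by (auto intro: LIMSEQ_unique)
  qed
  show ?thesis
  proof (rule measure_eqI_generator_eq[where \<Omega>=UNIV and E="{U. open U}" and A="\<lambda>_. UNIV"])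
    show "emeasure M X = emeasure N X" if "X \<in> {U. open U}" for X
      using op that by (simp add: M.emeasure_eq_measure N.emeasure_eq_measure)
  qed (use M(2) N(2) in \<open>auto simp: Int_stable_def borel_def M.emeasure_eq_measure\<close>)
qed

text \<open>
  The substitution \<open>y $ i = exp (- x $ i)\<close> maps the orthant into the unit cube and turns the values
  of the Laplace transform at integer points into the moments of the image measure.
\<close>

lemma measure_eq_of_laplace:
  fixes M N :: "(real ^ 'n) measure"
  assumes M: "prob_space M" "sets M = sets borel" "AE x in M. x \<in> pos_orthant"
    and N: "prob_space N" "sets N = sets borel" "AE x in N. x \<in> pos_orthant"
    and eq: "\<And>t. (\<forall>i. 0 \<le> t $ i) \<Longrightarrow> (\<integral>x. exp (- (\<Sum>i\<in>UNIV. t $ i * x $ i)) \<partial>M) =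
      (\<integral>x. exp (- (\<Sum>i\<in>UNIV. t $ i * x $ i)) \<partial>N)"
  shows "M = N"
proof -
  define \<phi> :: "real ^ 'n \<Rightarrow> real ^ 'n" where "\<phi> x = (\<chi> i. exp (- x $ i))" for x
  define \<psi> :: "real ^ 'n \<Rightarrow> real ^ 'n" where "\<psi> y = (\<chi> i. - ln (y $ i))" for y
  note [measurable_cong] = M(2) N(2)
  have [measurable]: "\<phi> \<in> borel_measurable borel" "\<psi> \<in> borel_measurable borel"
    unfolding \<phi>_def \<psi>_def by measurable
  have inv: "distr (distr K borel \<phi>) borel \<psi> = K"
    if [measurable_cong]: "sets K = sets borel" for K
  proof -
    have "distr (distr K borel \<phi>) borel \<psi> = distr K borel (\<lambda>x. x)"
      by (subst distr_distr) (auto simp: comp_def \<phi>_def \<psi>_def)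
    also have "\<dots> = K" using that by (metis distr_id2)
    finally show ?thesis .
  qed
  have mom: "(\<integral>y. (\<Prod>i\<in>UNIV. (y $ i) ^ k i) \<partial>distr K borel \<phi>)
      = (\<integral>x. exp (- (\<Sum>i\<in>UNIV. (\<chi> i. real (k i)) $ i * x $ i)) \<partial>K)"
    if [measurable_cong]: "sets K = sets borel" for K and k :: "'n \<Rightarrow> nat"
    by (subst integral_distr)
       (auto simp: \<phi>_def exp_sum sum_negf[symmetric] exp_of_nat_mult[symmetric])
  have AE: "AE y in distr K borel \<phi>. y \<in> cbox 0 1"
    if [measurable_cong]: "sets K = sets borel" and "AE x in K. x \<in> pos_orthant" for K
    using that(2) by (subst AE_distr_iff) (auto simp: pos_orthant_def \<phi>_def mem_box_cart less_imp_le)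
  have "distr M borel \<phi> = distr N borel \<phi>"
  proof (rule measure_eq_of_moments[where S="cbox 0 1"])
    show "prob_space (distr M borel \<phi>)" "prob_space (distr N borel \<phi>)"
      using M N by (auto intro!: prob_space.prob_space_distr)
    show "(\<integral>y. (\<Prod>i\<in>UNIV. (y $ i) ^ k i) \<partial>distr M borel \<phi>)
      = (\<integral>y. (\<Prod>i\<in>UNIV. (y $ i) ^ k i) \<partial>distr N borel \<phi>)" for k
      unfolding mom[OF M(2)] mom[OF N(2)] by (rule eq) simp
  qed (use M N AE in auto)
  then show ?thesis using inv[OF M(2)] inv[OF N(2)] by metis
qed

section \<open>The kernel of the inverse matrix\<close>

lemma matrix_inv_mult:
  fixes A :: "real ^ 'n ^ 'n"
  assumes "invertible A"
  shows "A ** matrix_inv A = mat 1" "matrix_inv A ** A = mat 1"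
  using someI_ex[OF assms[unfolded invertible_def]] by (simp_all add: matrix_inv_def)

text \<open>
  A vector \<open>v\<close> on which the form vanishes minimises it. If \<open>w = R *v v\<close> were nonzero, the form
  would be negative at \<open>v + s *\<^sub>R w\<close> for a small negative \<open>s\<close>, which contradicts semidefiniteness.
\<close>

lemma pos_def_sym_of_correlation_matrix:
  fixes R :: "real ^ 'n ^ 'n"
  assumes R: "correlation_matrix R" and inv: "invertible R"
  shows "pos_def_sym R"
  unfolding pos_def_sym_def
proof (intro conjI allI impI)
  show sym: "transpose R = R" using R by (simp add: correlation_matrix_def)
  have psd: "0 \<le> v \<bullet> (R *v v)" for v using R by (simp add: correlation_matrix_def)
  fix v :: "real ^ 'n" assume "v \<noteq> 0"
  define w where "w = R *v v"
  have "w \<noteq> 0"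
    using \<open>v \<noteq> 0\<close> inv unfolding w_def
    by (metis matrix_inv_mult(2) matrix_vector_mul_assoc matrix_vector_mul_lid matrix_vector_mult_0_right)
  show "0 < v \<bullet> (R *v v)"
  proof (rule ccontr)
    assume "\<not> 0 < v \<bullet> (R *v v)"
    with psd[of v] have v0: "v \<bullet> w = 0" by (simp add: w_def)
    \<comment> \<open>any \<open>s\<close> strictly between \<open>- 2 * a / c\<close> and \<open>0\<close> makes the form negative; the summand 1 covers \<open>c = 0\<close>\<close>
    define a c s where "a = w \<bullet> w" and "c = w \<bullet> (R *v w)" and "s = - a / (c + 1)"
    have a: "a > 0" using \<open>w \<noteq> 0\<close> by (simp add: a_def)
    have c: "c \<ge> 0" using psd by (simp add: c_def)
    have cross: "v \<bullet> (R *v w) = a"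
      using sym by (metis a_def dot_lmul_matrix vector_transpose_matrix w_def)
    have "0 \<le> (v + s *\<^sub>R w) \<bullet> (R *v (v + s *\<^sub>R w))" by (rule psd)
    also have "\<dots> = 2 * s * a + s\<^sup>2 * c"
      by (simp add: matrix_vector_right_distrib matrix_vector_mult_scaleR inner_add_left inner_add_right
          w_def[symmetric] v0 cross a_def[symmetric] c_def[symmetric] power2_eq_square algebra_simps)
    also have "\<dots> = - (a\<^sup>2 / (c + 1)\<^sup>2 * (c + 2))"
      using c by (simp add: s_def divide_simps power2_eq_square) (simp add: algebra_simps)
    also have "\<dots> < 0" using a c by simp
    finally show False by simp
  qed
qed

text \<open>
  Since the inverse \<open>Q\<close> is symmetric, \<open>Q = Q ** R ** transpose Q\<close> is congruent to \<open>R\<close>.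
\<close>

lemma pos_def_sym_matrix_inv:
  fixes R :: "real ^ 'n ^ 'n"
  assumes R: "pos_def_sym R" and inv: "invertible R"
  shows "pos_def_sym (matrix_inv R)"
proof -
  let ?Q = "matrix_inv R"
  have "transpose ?Q ** R = mat 1"
    using R matrix_inv_mult(1)[OF inv] by (metis matrix_transpose_mul pos_def_sym_def transpose_mat)
  then have "transpose ?Q = ?Q"
    by (metis matrix_inv_mult(1)[OF inv] matrix_mul_assoc matrix_mul_lid matrix_mul_rid)
  then have "?Q ** R ** transpose ?Q = ?Q"
    by (simp add: matrix_inv_mult[OF inv])
  moreover have "det ?Q \<noteq> 0"
    using matrix_inv_mult[OF inv] by (metis invertible_def invertible_det_nz)
  ultimately show ?thesis using pos_def_sym_congruence[OF R] by metis
qed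

lemma pos_def_sym_add_diag:
  fixes Q :: "real ^ 'n ^ 'n"
  assumes Q: "pos_def_sym Q" and t: "\<forall>i. 0 \<le> t $ i"
  shows "pos_def_sym (Q + diag_matrix t)"
  unfolding pos_def_sym_def
proof (intro conjI allI impI)
  show "transpose (Q + diag_matrix t) = Q + diag_matrix t"
    using Q unfolding pos_def_sym_def by (auto simp: vec_eq_iff transpose_def diag_matrix_def)
  fix v :: "real ^ 'n" assume v: "v \<noteq> 0"
  have "(diag_matrix t *v v) $ i = t $ i * v $ i" for i
  proof -
    have "(diag_matrix t *v v) $ i = (\<Sum>j\<in>UNIV. (if i = j then t $ i else 0) * v $ j)"
      by (simp add: matrix_vector_mult_def diag_matrix_def)
    also have "\<dots> = (\<Sum>j\<in>UNIV. if j = i then t $ i * v $ i else 0)"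
      by (intro sum.cong refl) auto
    finally show ?thesis by simp
  qed
  then have "v \<bullet> (diag_matrix t *v v) = (\<Sum>i\<in>UNIV. t $ i * (v $ i)\<^sup>2)"
    by (simp add: inner_vec_def power2_eq_square ac_simps)
  then have "0 \<le> v \<bullet> (diag_matrix t *v v)" using t by (simp add: sum_nonneg)
  then show "0 < v \<bullet> ((Q + diag_matrix t) *v v)"
    using Q v by (simp add: matrix_vector_mult_add_rdistrib inner_add_right pos_def_sym_def add_pos_nonneg)
qed

lemma matrix_graph_edges_add_diag: "matrix_graph_edges (Q + diag_matrix t) = matrix_graph_edges Q"
  by (auto simp: matrix_graph_edges_def diag_matrix_def)

text \<open>
  The exponential factor of a Laplace transform at \<open>t\<close> is absorbed by adding \<open>t\<close> to the
  diagonal, which reduces the whole Laplace transform to total masses of kernels.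
\<close>

lemma orthant_kernel_eq_gamma_tree_kernel:
  "orthant_kernel \<alpha> (matrix_inv R + diag_matrix t) (\<lambda>i. x $ i) =
    indicator pos_orthant x * gamma_tree_kernel \<alpha> R x * exp (- (\<Sum>i\<in>UNIV. t $ i * x $ i))"
proof -
  let ?Q = "matrix_inv R"
  have ind: "(\<Prod>i\<in>UNIV. indicator {0<..} (x $ i)) = (indicator pos_orthant x :: real)"
  proof (cases "x \<in> pos_orthant")
    case True
    then show ?thesis by (simp add: pos_orthant_def)
  next
    case False
    then obtain i where "\<not> 0 < x $ i" by (auto simp: pos_orthant_def)
    then have "(\<Prod>i\<in>UNIV. indicator {0<..} (x $ i)) = (0::real)"
      by (intro prod_zero bexI[of _ i]) auto
    then show ?thesis using False by simp
  qed
  have "(\<Prod>i\<in>UNIV. indicator {0<..} (x $ i) * (x $ i powr (\<alpha> - 1) * exp (- ((?Q + diag_matrix t) $ i $ i * x $ i))))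
    = (\<Prod>i\<in>UNIV. indicator {0<..} (x $ i) * ((x $ i powr (\<alpha> - 1) * exp (- (?Q $ i $ i * x $ i))) * exp (- (t $ i * x $ i))))"
    by (intro prod.cong refl) (simp add: diag_matrix_def distrib_right exp_diff divide_inverse exp_minus)
  also have "\<dots> = indicator pos_orthant x * (\<Prod>i\<in>UNIV. x $ i powr (\<alpha> - 1) * exp (- (?Q $ i $ i * x $ i)))
       * exp (- (\<Sum>i\<in>UNIV. t $ i * x $ i))"
    by (simp add: prod.distrib ind exp_sum[symmetric] sum_negf)
  finally have single: "(\<Prod>i\<in>UNIV. indicator {0<..} (x $ i) * (x $ i powr (\<alpha> - 1) * exp (- ((?Q + diag_matrix t) $ i $ i * x $ i))))
    = indicator pos_orthant x * (\<Prod>i\<in>UNIV. x $ i powr (\<alpha> - 1) * exp (- (?Q $ i $ i * x $ i)))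
       * exp (- (\<Sum>i\<in>UNIV. t $ i * x $ i))" .
  have pairs: "(\<Prod>(i, j)\<in>{(i, j). i < j}. hypergeom_0F1 \<alpha> (((?Q + diag_matrix t) $ i $ j)\<^sup>2 * x $ i * x $ j))
     = (\<Prod>(i, j)\<in>{(i, j). i < j}. hypergeom_0F1 \<alpha> ((?Q $ i $ j)\<^sup>2 * x $ i * x $ j))"
    by (intro prod.cong refl) (auto simp: diag_matrix_def)
  show ?thesis
    unfolding orthant_kernel_def gamma_tree_kernel_def single pairs by (simp add: ac_simps)
qed

lemma borel_measurable_gamma_tree_kernel [measurable]:
  "gamma_tree_kernel \<alpha> R \<in> borel_measurable borel"
  unfolding gamma_tree_kernel_def[abs_def]
  by (intro borel_measurable_times borel_measurable_prod) (auto simp: split_beta)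

lemma sets_pos_orthant [measurable]: "pos_orthant \<in> sets (borel :: (real ^ 'n) measure)"
  unfolding pos_orthant_def by measurable

lemma gamma_tree_kernel_pos:
  assumes "\<alpha> > 0" "x \<in> pos_orthant"
  shows "0 < gamma_tree_kernel \<alpha> R x"
proof -
  have x: "x $ i > 0" for i using assms by (simp add: pos_orthant_def)
  have "0 < hypergeom_0F1 \<alpha> ((matrix_inv R $ i $ j)\<^sup>2 * x $ i * x $ j)" for i j
    by (intro less_le_trans[OF zero_less_one hypergeom_0F1_ge_1] assms mult_nonneg_nonneg) (auto intro: less_imp_le x)
  then show ?thesis
    unfolding gamma_tree_kernel_def using x by (intro mult_pos_pos prod_pos) (auto simp: less_imp_neq[symmetric])
qed

text \<open>
  A product of log-supermodular factors is log-supermodular. Factors of a single coordinate give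
  equality, and those of two coordinates are TP2.
\<close>

lemma gamma_tree_kernel_log_supermodular:
  assumes "\<alpha> > 0" and x: "x \<in> pos_orthant" and y: "y \<in> pos_orthant"
  shows "gamma_tree_kernel \<alpha> R x * gamma_tree_kernel \<alpha> R y
    \<le> gamma_tree_kernel \<alpha> R (sup x y) * gamma_tree_kernel \<alpha> R (inf x y)"
proof -
  let ?Q = "matrix_inv R"
  define g where "g i u = u powr (\<alpha> - 1) * exp (- (?Q $ i $ i * u))" for i and u :: real
  define G where "G p u = hypergeom_0F1 \<alpha> ((?Q $ fst p $ snd p)\<^sup>2 * u $ fst p * u $ snd p)" for p u
  have K: "gamma_tree_kernel \<alpha> R u = (\<Prod>i\<in>UNIV. g i (u $ i)) * (\<Prod>p\<in>{(i, j). i < j}. G p u)" for u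
    by (simp add: gamma_tree_kernel_def g_def G_def split_beta)
  have pos: "0 < x $ i" "0 < y $ i" for i
    using x y by (simp_all add: pos_orthant_def)
  have single: "g i (x $ i) * g i (y $ i) = g i (sup x y $ i) * g i (inf x y $ i)" for i
    by (auto simp: sup_vec_def inf_vec_def sup_real_def inf_real_def max_def min_def)
  have Gpos: "0 \<le> G p u" if "u \<in> {x, y}" for p u
    unfolding G_def
    by (intro order_trans[OF zero_le_one hypergeom_0F1_ge_1] \<open>\<alpha> > 0\<close> mult_nonneg_nonneg) (use that pos in \<open>auto intro: less_imp_le\<close>)
  have pair: "G p x * G p y \<le> G p (sup x y) * G p (inf x y)" for p
  proof -
    obtain i j where p: "p = (i, j)" by (cases p)
    have *: "G p u * G p v \<le> G p (sup u v) * G p (inf u v)"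
      if uv: "u \<in> {x, y}" "v \<in> {x, y}" and le: "u $ i \<le> v $ i" for u v
    proof (cases "u $ j \<le> v $ j")
      case True
      then have "G p (sup u v) = G p v" "G p (inf u v) = G p u"
        using le by (simp_all add: G_def p sup_vec_def inf_vec_def sup_real_def inf_real_def)
      then show ?thesis by simp
    next
      case False
      have "hypergeom_0F1 \<alpha> ((?Q $ i $ j)\<^sup>2 * u $ i * u $ j) * hypergeom_0F1 \<alpha> ((?Q $ i $ j)\<^sup>2 * v $ i * v $ j)
        \<le> hypergeom_0F1 \<alpha> ((?Q $ i $ j)\<^sup>2 * u $ i * v $ j) * hypergeom_0F1 \<alpha> ((?Q $ i $ j)\<^sup>2 * v $ i * u $ j)"
        using uv le False pos by (intro hypergeom_0F1_TP2 \<open>\<alpha> > 0\<close>) (auto intro: less_imp_le)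
      then show ?thesis
        using le False by (simp add: G_def p sup_vec_def inf_vec_def sup_real_def inf_real_def ac_simps)
    qed
    show ?thesis
      using *[of x y] *[of y x] by (cases "x $ i \<le> y $ i") (simp_all add: sup_commute inf_commute ac_simps)
  qed
  have "gamma_tree_kernel \<alpha> R x * gamma_tree_kernel \<alpha> R y =
     (\<Prod>i\<in>UNIV. g i (x $ i) * g i (y $ i)) * (\<Prod>p\<in>{(i, j). i < j}. G p x * G p y)"
    by (simp add: K prod.distrib ac_simps)
  also have "\<dots> \<le> (\<Prod>i\<in>UNIV. g i (x $ i) * g i (y $ i)) * (\<Prod>p\<in>{(i, j). i < j}. G p (sup x y) * G p (inf x y))"
    using pair Gpos by (intro mult_left_mono prod_mono prod_nonneg) (auto simp: g_def)
  also have "\<dots> = gamma_tree_kernel \<alpha> R (sup x y) * gamma_tree_kernel \<alpha> R (inf x y)"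
    by (simp add: K single prod.distrib ac_simps)
  finally show ?thesis .
qed

section \<open>The multivariate gamma distribution of tree type\<close>

definition gamma_tree_density ::
  "real \<Rightarrow> real ^ 'n::{finite, linorder} ^ 'n::{finite, linorder} \<Rightarrow> real ^ 'n::{finite, linorder} \<Rightarrow> real" where
  "gamma_tree_density \<alpha> R x = det R powr (- \<alpha>) / Gamma \<alpha> ^ CARD('n) * gamma_tree_kernel \<alpha> R x"

text \<open>
  With \<open>Q\<close> the inverse of \<open>R\<close>, the factorisation \<open>mat 1 + R ** T = R ** (Q + T)\<close> splits the
  determinant and thereby dictates the normalising constant.
\<close>

lemma nn_integral_gamma_tree_density:
  fixes R :: "real ^ 'n::{finite, linorder} ^ 'n::{finite, linorder}"
  assumes R: "correlation_matrix R" "invertible R" "tree_type (matrix_inv R)" and "\<alpha> > 0"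
    and t: "\<forall>i. 0 \<le> t $ i"
  shows "0 < det R"
    and "(\<integral>\<^sup>+x. ennreal (indicator pos_orthant x * gamma_tree_density \<alpha> R x * exp (- (\<Sum>i\<in>UNIV. t $ i * x $ i))) \<partial>lborel)
      = ennreal (det (mat 1 + R ** diag_matrix t) powr (- \<alpha>))"
proof -
  let ?Q = "matrix_inv R"
  have Q: "pos_def_sym ?Q"
    using R by (intro pos_def_sym_matrix_inv pos_def_sym_of_correlation_matrix)
  have main: "0 < det (?Q + diag_matrix s) \<and>
    (\<integral>\<^sup>+x. ennreal (indicator pos_orthant x * gamma_tree_kernel \<alpha> R x * exp (- (\<Sum>i\<in>UNIV. s $ i * x $ i))) \<partial>lborel)
      = ennreal (Gamma \<alpha> ^ CARD('n) * det (?Q + diag_matrix s) powr (- \<alpha>))"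
    if s: "\<forall>i. 0 \<le> s $ i" for s
  proof -
    have "\<nexists>vs. graph_cycle (matrix_graph_edges (?Q + diag_matrix s)) vs"
      using R(3) by (simp add: matrix_graph_edges_add_diag tree_type_def)
    note * = nn_integral_orthant_kernel[OF \<open>\<alpha> > 0\<close> pos_def_sym_add_diag[OF Q s] this]
    have "(\<integral>\<^sup>+x. ennreal (indicator pos_orthant x * gamma_tree_kernel \<alpha> R x * exp (- (\<Sum>i\<in>UNIV. s $ i * x $ i))) \<partial>lborel)
      = (\<integral>\<^sup>+x. ennreal (orthant_kernel \<alpha> (?Q + diag_matrix s) x) \<partial>(\<Pi>\<^sub>M i\<in>UNIV. lborel))"
    proof (subst nn_integral_lborel_vec)
      show "(\<lambda>x. ennreal (indicator pos_orthant x * gamma_tree_kernel \<alpha> R x * exp (- (\<Sum>i\<in>UNIV. s $ i * x $ i)))) \<in> borel_measurable borel"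
        by measurable
      have "indicator pos_orthant (\<chi> i. x i) * gamma_tree_kernel \<alpha> R (\<chi> i. x i) * exp (- (\<Sum>i\<in>UNIV. s $ i * (\<chi> i. x i) $ i))
        = orthant_kernel \<alpha> (?Q + diag_matrix s) x" for x
        using orthant_kernel_eq_gamma_tree_kernel[of \<alpha> R s "\<chi> i. x i"] by simp
      then show "(\<integral>\<^sup>+x. ennreal (indicator pos_orthant (\<chi> i. x i) * gamma_tree_kernel \<alpha> R (\<chi> i. x i) * exp (- (\<Sum>i\<in>UNIV. s $ i * (\<chi> i. x i) $ i))) \<partial>(\<Pi>\<^sub>M i\<in>UNIV. lborel))
        = (\<integral>\<^sup>+x. ennreal (orthant_kernel \<alpha> (?Q + diag_matrix s) x) \<partial>(\<Pi>\<^sub>M i\<in>UNIV. lborel))"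
        by (simp only:)
    qed
    with * show ?thesis by simp
  qed
  have zero: "diag_matrix 0 = 0" by (simp add: diag_matrix_def vec_eq_iff)
  have "det R * det ?Q = 1"
    using matrix_inv_mult(1)[OF R(2)] by (metis det_I det_mul)
  moreover have "0 < det ?Q" using main[of 0] by (simp add: zero)
  ultimately show detR: "0 < det R" by (metis zero_less_mult_pos2 zero_less_one)
  have "mat 1 + R ** diag_matrix t = R ** (?Q + diag_matrix t)"
    by (simp add: matrix_add_ldistrib matrix_inv_mult[OF R(2)])
  then have det: "det (mat 1 + R ** diag_matrix t) powr (- \<alpha>) = det R powr (- \<alpha>) * det (?Q + diag_matrix t) powr (- \<alpha>)"
    using detR main[OF t] by (simp add: det_mul powr_mult)
  have Gamma: "Gamma \<alpha> > 0" using \<open>\<alpha> > 0\<close> by (rule Gamma_real_pos)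
  have "(\<integral>\<^sup>+x. ennreal (indicator pos_orthant x * gamma_tree_density \<alpha> R x * exp (- (\<Sum>i\<in>UNIV. t $ i * x $ i))) \<partial>lborel)
    = (\<integral>\<^sup>+x. ennreal (det R powr (- \<alpha>) / Gamma \<alpha> ^ CARD('n)) *
        ennreal (indicator pos_orthant x * gamma_tree_kernel \<alpha> R x * exp (- (\<Sum>i\<in>UNIV. t $ i * x $ i))) \<partial>lborel)"
    using Gamma by (intro nn_integral_cong) (simp add: gamma_tree_density_def ac_simps flip: ennreal_mult')
  also have "\<dots> = ennreal (det R powr (- \<alpha>) / Gamma \<alpha> ^ CARD('n)) *
      ennreal (Gamma \<alpha> ^ CARD('n) * det (?Q + diag_matrix t) powr (- \<alpha>))"
    using main[OF t] by (subst nn_integral_cmult) simp_all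
  also have "\<dots> = ennreal (det (mat 1 + R ** diag_matrix t) powr (- \<alpha>))"
    using Gamma by (simp add: det flip: ennreal_mult')
  finally show "(\<integral>\<^sup>+x. ennreal (indicator pos_orthant x * gamma_tree_density \<alpha> R x * exp (- (\<Sum>i\<in>UNIV. t $ i * x $ i))) \<partial>lborel)
      = ennreal (det (mat 1 + R ** diag_matrix t) powr (- \<alpha>))" .
qed

definition gamma_tree_measure ::
  "real \<Rightarrow> real ^ 'n::{finite, linorder} ^ 'n::{finite, linorder} \<Rightarrow> (real ^ 'n::{finite, linorder}) measure" where
  "gamma_tree_measure \<alpha> R = density lborel (\<lambda>x. ennreal (indicator pos_orthant x * gamma_tree_density \<alpha> R x))"

lemma borel_measurable_gamma_tree_density [measurable]:
  "gamma_tree_density \<alpha> R \<in> borel_measurable borel"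
  unfolding gamma_tree_density_def[abs_def] by measurable

lemma multivariate_gamma_gamma_tree_measure:
  fixes R :: "real ^ 'n::{finite, linorder} ^ 'n::{finite, linorder}"
  assumes R: "correlation_matrix R" "invertible R" "tree_type (matrix_inv R)" and "\<alpha> > 0"
  shows "multivariate_gamma \<alpha> R (gamma_tree_measure \<alpha> R)"
proof -
  let ?M = "gamma_tree_measure \<alpha> R"
  have sets: "sets ?M = sets borel" by (simp add: gamma_tree_measure_def)
  have dens: "0 \<le> indicator pos_orthant x * gamma_tree_density \<alpha> R x" for x
    using gamma_tree_kernel_pos[OF \<open>\<alpha> > 0\<close>, of x R] Gamma_real_pos[OF \<open>\<alpha> > 0\<close>]
    by (auto simp: gamma_tree_density_def indicator_def less_imp_le)
  have nn: "(\<integral>\<^sup>+x. ennreal (exp (- (\<Sum>i\<in>UNIV. t $ i * x $ i))) \<partial>?M) = ennreal (det (mat 1 + R ** diag_matrix t) powr (- \<alpha>))"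
    if t: "\<forall>i. 0 \<le> t $ i" for t
  proof -
    have "(\<integral>\<^sup>+x. ennreal (exp (- (\<Sum>i\<in>UNIV. t $ i * x $ i))) \<partial>?M)
      = (\<integral>\<^sup>+x. ennreal (indicator pos_orthant x * gamma_tree_density \<alpha> R x) * ennreal (exp (- (\<Sum>i\<in>UNIV. t $ i * x $ i))) \<partial>lborel)"
      unfolding gamma_tree_measure_def by (subst nn_integral_density) measurable
    also have "\<dots> = (\<integral>\<^sup>+x. ennreal (indicator pos_orthant x * gamma_tree_density \<alpha> R x * exp (- (\<Sum>i\<in>UNIV. t $ i * x $ i))) \<partial>lborel)"
      by (intro nn_integral_cong ennreal_mult[symmetric] dens exp_ge_zero)
    also have "\<dots> = ennreal (det (mat 1 + R ** diag_matrix t) powr (- \<alpha>))"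
      by (rule nn_integral_gamma_tree_density(2)[OF assms t])
    finally show ?thesis .
  qed
  have zero: "diag_matrix 0 = 0" by (simp add: diag_matrix_def vec_eq_iff)
  have "R ** 0 = 0" by (simp add: matrix_matrix_mult_def vec_eq_iff)
  then have "emeasure ?M (space ?M) = 1"
    using nn[of 0] by (simp add: zero)
  then have "prob_space ?M" by (rule prob_spaceI)
  moreover have "AE x in ?M. x \<in> pos_orthant"
    unfolding gamma_tree_measure_def by (subst AE_density) (auto simp: indicator_def)
  moreover have "(\<integral>x. exp (- (\<Sum>i\<in>UNIV. t $ i * x $ i)) \<partial>?M) = det (mat 1 + R ** diag_matrix t) powr (- \<alpha>)"
    if t: "\<forall>i. 0 \<le> t $ i" for t
  proof -
    have [measurable]: "(\<lambda>x. exp (- (\<Sum>i\<in>UNIV. t $ i * x $ i))) \<in> borel_measurable ?M"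
      unfolding gamma_tree_measure_def by measurable
    show ?thesis
      by (subst integral_eq_nn_integral) (simp_all add: nn[OF t])
  qed
  ultimately show ?thesis using sets by (simp add: multivariate_gamma_def)
qed

lemma multivariate_gamma_unique:
  fixes M N :: "(real ^ 'n) measure"
  assumes "multivariate_gamma \<alpha> R M" "multivariate_gamma \<alpha> R N"
  shows "M = N"
  using assms by (intro measure_eq_of_laplace) (simp_all add: multivariate_gamma_def)

lemma measure_gamma_tree_measure_lattice:
  fixes R :: "real ^ 'n::{finite, linorder} ^ 'n::{finite, linorder}"
  assumes fin: "finite_measure (gamma_tree_measure \<alpha> R)" and "\<alpha> > 0"
    and "A \<in> sets borel" "B \<in> sets borel" "C \<in> sets borel" "D \<in> sets borel"
    and "\<And>x y. x \<in> A \<Longrightarrow> y \<in> B \<Longrightarrow> sup x y \<in> C \<and> inf x y \<in> D"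
  shows "measure (gamma_tree_measure \<alpha> R) A * measure (gamma_tree_measure \<alpha> R) B
    \<le> measure (gamma_tree_measure \<alpha> R) C * measure (gamma_tree_measure \<alpha> R) D"
proof -
  interpret finite_measure "gamma_tree_measure \<alpha> R" by fact
  let ?f = "\<lambda>x. ennreal (indicator pos_orthant x * gamma_tree_density \<alpha> R x)"
  have "emeasure (density lborel ?f) A * emeasure (density lborel ?f) B
    \<le> emeasure (density lborel ?f) C * emeasure (density lborel ?f) D"
  proof (rule emeasure_lattice_density)
    show "?f x * ?f y \<le> ?f (sup x y) * ?f (inf x y)" for x y
    proof (cases "x \<in> pos_orthant \<and> y \<in> pos_orthant")
      case True
      define c where "c = det R powr (- \<alpha>) / Gamma \<alpha> ^ CARD('n)"
      have c: "c \<ge> 0" using Gamma_real_pos[OF \<open>\<alpha> > 0\<close>] by (simp add: c_def)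
      have K: "gamma_tree_density \<alpha> R u = c * gamma_tree_kernel \<alpha> R u" for u
        by (simp add: gamma_tree_density_def c_def)
      have si: "sup x y \<in> pos_orthant" "inf x y \<in> pos_orthant"
        using True by (simp_all add: pos_orthant_def sup_vec_def inf_vec_def sup_real_def inf_real_def less_max_iff_disj)
      have nonneg: "0 \<le> gamma_tree_density \<alpha> R u" if "u \<in> pos_orthant" for u
        using gamma_tree_kernel_pos[OF \<open>\<alpha> > 0\<close> that, of R] c by (simp add: K)
      have "(c * c) * (gamma_tree_kernel \<alpha> R x * gamma_tree_kernel \<alpha> R y)
        \<le> (c * c) * (gamma_tree_kernel \<alpha> R (sup x y) * gamma_tree_kernel \<alpha> R (inf x y))"
        using True c by (intro mult_left_mono gamma_tree_kernel_log_supermodular \<open>\<alpha> > 0\<close>) auto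
      then have "gamma_tree_density \<alpha> R x * gamma_tree_density \<alpha> R y
        \<le> gamma_tree_density \<alpha> R (sup x y) * gamma_tree_density \<alpha> R (inf x y)"
        by (simp add: K ac_simps)
      then show ?thesis
        using True si nonneg by (simp flip: ennreal_mult)
    qed auto
  qed (use assms in auto)
  then have "ennreal (measure (gamma_tree_measure \<alpha> R) A * measure (gamma_tree_measure \<alpha> R) B)
    \<le> ennreal (measure (gamma_tree_measure \<alpha> R) C * measure (gamma_tree_measure \<alpha> R) D)"
    unfolding gamma_tree_measure_def[symmetric] by (simp add: emeasure_eq_measure ennreal_mult)
  then show ?thesis by (simp add: ennreal_le_iff)
qed

lemma sets_lower_orthant [measurable]:
  "{y :: real ^ 'n. \<forall>i\<in>J. y $ i \<le> x $ i} \<in> sets borel"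
proof -
  have "closed (\<Inter>i\<in>J. {y :: real ^ 'n. y $ i \<le> x $ i})"
    by (intro closed_INT ballI closed_Collect_le continuous_intros)
  also have "(\<Inter>i\<in>J. {y :: real ^ 'n. y $ i \<le> x $ i}) = {y. \<forall>i\<in>J. y $ i \<le> x $ i}" by auto
  finally show ?thesis by simp
qed

lemma measure_lower_orthant_pos:
  fixes R :: "real ^ 'n::{finite, linorder} ^ 'n::{finite, linorder}"
  assumes fin: "finite_measure (gamma_tree_measure \<alpha> R)" and "\<alpha> > 0" "det R > 0"
    and x: "x \<in> pos_orthant"
  shows "0 < measure (gamma_tree_measure \<alpha> R) {y. \<forall>i\<in>J. y $ i \<le> x $ i}"
proof (rule ccontr)
  interpret finite_measure "gamma_tree_measure \<alpha> R" by fact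
  let ?S = "{y. \<forall>i\<in>J. y $ i \<le> x $ i}"
  assume "\<not> 0 < measure (gamma_tree_measure \<alpha> R) ?S"
  then have "emeasure (gamma_tree_measure \<alpha> R) ?S = 0"
    by (simp add: emeasure_eq_measure zero_less_measure_iff)
  then have "?S \<in> null_sets (gamma_tree_measure \<alpha> R)"
    by (intro null_setsI) (simp_all add: gamma_tree_measure_def)
  then have "AE y in lborel. y \<in> ?S \<longrightarrow> ennreal (indicator pos_orthant y * gamma_tree_density \<alpha> R y) = 0"
    unfolding gamma_tree_measure_def by (subst (asm) null_sets_density_iff) simp_all
  then have "AE y in lborel. y \<notin> box 0 x"
  proof eventually_elim
    case (elim y)
    show ?case
    proof
      assume y: "y \<in> box 0 x"
      then have yp: "y \<in> pos_orthant" and yS: "y \<in> ?S"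
        by (auto simp: mem_box_cart pos_orthant_def less_imp_le)
      have "0 < gamma_tree_density \<alpha> R y"
        using gamma_tree_kernel_pos[OF \<open>\<alpha> > 0\<close> yp] Gamma_real_pos[OF \<open>\<alpha> > 0\<close>] \<open>det R > 0\<close>
        by (simp add: gamma_tree_density_def)
      then show False using elim yp yS by (simp add: ennreal_eq_0_iff)
    qed
  qed
  then have "emeasure lborel (box 0 x) = 0"
    by (subst (asm) AE_iff_measurable[of "box 0 x"]) auto
  moreover have "emeasure lborel (box 0 x) = ennreal (\<Prod>b\<in>Basis. x \<bullet> b)"
    using x by (subst emeasure_lborel_box)
      (auto simp: Basis_vec_def inner_axis pos_orthant_def less_imp_le)
  moreover have "(\<Prod>b\<in>Basis. x \<bullet> b) > 0"
    using x by (intro prod_pos) (auto simp: Basis_vec_def inner_axis pos_orthant_def)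
  ultimately show False by (simp add: ennreal_eq_0_iff)
qed

theorem mainTheorem3:
  fixes R :: "real ^ 'n::{finite, linorder} ^ 'n::{finite, linorder}" and \<alpha> :: real
  assumes "CARD('n) \<ge> 2"
    and "correlation_matrix R" and "invertible R"
    and "tree_type (matrix_inv R)"
    and "\<alpha> > 0"
  shows
    "(\<exists>!M. multivariate_gamma \<alpha> R M) \<and>
     (\<forall>M. multivariate_gamma \<alpha> R M \<longrightarrow>
        (\<exists>c>0.
           distributed M lborel (\<lambda>x. x)
             (\<lambda>x. ennreal (indicator pos_orthant x * (c * gamma_tree_kernel \<alpha> R x))) \<and>
           MTP2 (\<lambda>x. c * gamma_tree_kernel \<alpha> R x)) \<and>
        MTP2 (joint_cdf M)) \<and>
     (\<forall>(N :: 'w measure) X.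
        prob_space N \<and> X \<in> borel_measurable N \<and> multivariate_gamma \<alpha> R (distr N borel X) \<longrightarrow>
        (\<forall>x b I. (\<forall>i. 0 < x $ i \<and> x $ i \<le> b $ i) \<and> I \<noteq> {} \<and> I \<noteq> UNIV \<longrightarrow>
           (let A = (\<lambda>i. {\<omega> \<in> space N. X \<omega> $ i \<le> x $ i});
                B = (\<lambda>i. {\<omega> \<in> space N. X \<omega> $ i \<le> b $ i})
            in measure N (\<Inter>i. A i) / (measure N (\<Inter>i\<in>I. A i) * measure N (\<Inter>i\<in>- I. A i))
             \<ge> measure N (\<Inter>i. B i) / (measure N (\<Inter>i\<in>I. B i) * measure N (\<Inter>i\<in>- I. B i)))))"
proof -
  define \<mu> where "\<mu> = gamma_tree_measure \<alpha> R"
  define c where "c = det R powr (- \<alpha>) / Gamma \<alpha> ^ CARD('n)"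
  define F where "F J x = measure \<mu> {y. \<forall>i\<in>J. y $ i \<le> x $ i}" for J :: "'n set" and x
  have \<mu>: "multivariate_gamma \<alpha> R \<mu>"
    unfolding \<mu>_def by (rule multivariate_gamma_gamma_tree_measure[OF assms(2-)])
  then have uniq: "M = \<mu>" if "multivariate_gamma \<alpha> R M" for M
    using that by (rule multivariate_gamma_unique[rotated])
  interpret \<mu>: prob_space \<mu> using \<mu> by (simp add: multivariate_gamma_def)
  have fin: "finite_measure (gamma_tree_measure \<alpha> R)"
    using \<mu>.finite_measure_axioms by (simp add: \<mu>_def)
  have sets: "sets \<mu> = sets borel" using \<mu> by (simp add: multivariate_gamma_def)
  have detR: "det R > 0"
    using nn_integral_gamma_tree_density(1)[OF assms(2-), of 0] by simp
  have c: "c > 0" using detR Gamma_real_pos[OF \<open>\<alpha> > 0\<close>] by (simp add: c_def)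
  have dens: "\<mu> = density lborel (\<lambda>x. ennreal (indicator pos_orthant x * (c * gamma_tree_kernel \<alpha> R x)))"
    by (simp add: \<mu>_def gamma_tree_measure_def gamma_tree_density_def[abs_def] c_def)
  have distributed: "distributed \<mu> lborel (\<lambda>x. x) (\<lambda>x. ennreal (indicator pos_orthant x * (c * gamma_tree_kernel \<alpha> R x)))"
    unfolding distributed_def
  proof (intro conjI)
    show "distr \<mu> lborel (\<lambda>x. x) = density lborel (\<lambda>x. ennreal (indicator pos_orthant x * (c * gamma_tree_kernel \<alpha> R x)))"
      using dens distr_id2[of lborel \<mu>] sets by simp
    show "(\<lambda>x. x) \<in> \<mu> \<rightarrow>\<^sub>M lborel"
      using sets by (intro measurable_ident_sets) simp
  qed measurable
  have kernel: "MTP2 (\<lambda>x. c * gamma_tree_kernel \<alpha> R x)"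
    unfolding MTP2_def
  proof (intro conjI ballI)
    show "0 < c * gamma_tree_kernel \<alpha> R x" if "x \<in> pos_orthant" for x
      using c gamma_tree_kernel_pos[OF \<open>\<alpha> > 0\<close> that] by simp
    fix x y :: "(real, 'n) vec" assume "x \<in> pos_orthant" "y \<in> pos_orthant"
    then have "(c * c) * (gamma_tree_kernel \<alpha> R x * gamma_tree_kernel \<alpha> R y)
        \<le> (c * c) * (gamma_tree_kernel \<alpha> R (sup x y) * gamma_tree_kernel \<alpha> R (inf x y))"
      using c by (intro mult_left_mono gamma_tree_kernel_log_supermodular \<open>\<alpha> > 0\<close>) auto
    then show "c * gamma_tree_kernel \<alpha> R x * (c * gamma_tree_kernel \<alpha> R y)
        \<le> c * gamma_tree_kernel \<alpha> R (sup x y) * (c * gamma_tree_kernel \<alpha> R (inf x y))"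
      by (simp add: ac_simps)
  qed
  have lattice: "measure \<mu> A * measure \<mu> B \<le> measure \<mu> C * measure \<mu> D"
    if "A \<in> sets borel" "B \<in> sets borel" "C \<in> sets borel" "D \<in> sets borel"
      "\<And>x y. x \<in> A \<Longrightarrow> y \<in> B \<Longrightarrow> sup x y \<in> C \<and> inf x y \<in> D" for A B C D
    unfolding \<mu>_def using measure_gamma_tree_measure_lattice[OF fin \<open>\<alpha> > 0\<close> that] .
  have F_pos: "F J x > 0" if "x \<in> pos_orthant" for J x
    unfolding F_def \<mu>_def by (rule measure_lower_orthant_pos[OF fin \<open>\<alpha> > 0\<close> detR that])
  have cdf: "joint_cdf \<mu> = F UNIV" by (simp add: joint_cdf_def F_def fun_eq_iff)
  have joint: "MTP2 (joint_cdf \<mu>)"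
    unfolding MTP2_def cdf
  proof (intro conjI ballI F_pos)
    fix x y :: "(real, 'n) vec"
    show "F UNIV x * F UNIV y \<le> F UNIV (sup x y) * F UNIV (inf x y)"
      unfolding F_def
      by (rule lattice) (auto simp: sup_vec_def inf_vec_def intro: le_supI1 le_supI2 le_infI1 le_infI2)
  qed
  have ratio: "measure N (\<Inter>i. {\<omega> \<in> space N. X \<omega> $ i \<le> b $ i}) /
        (measure N (\<Inter>i\<in>I. {\<omega> \<in> space N. X \<omega> $ i \<le> b $ i}) * measure N (\<Inter>i\<in>- I. {\<omega> \<in> space N. X \<omega> $ i \<le> b $ i}))
      \<le> measure N (\<Inter>i. {\<omega> \<in> space N. X \<omega> $ i \<le> x $ i}) /
        (measure N (\<Inter>i\<in>I. {\<omega> \<in> space N. X \<omega> $ i \<le> x $ i}) * measure N (\<Inter>i\<in>- I. {\<omega> \<in> space N. X \<omega> $ i \<le> x $ i}))"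
    if N: "prob_space N" and X [measurable]: "X \<in> borel_measurable N" and mg: "multivariate_gamma \<alpha> R (distr N borel X)"
      and xb: "\<forall>i. 0 < x $ i \<and> x $ i \<le> b $ i" and I: "I \<noteq> {}" "I \<noteq> UNIV"
    for N :: "'w measure" and X x b I
  proof -
    have N_F: "measure N (\<Inter>i\<in>J. {\<omega> \<in> space N. X \<omega> $ i \<le> z $ i}) = F J z" if "J \<noteq> {}" for J z
    proof -
      have "F J z = measure N (X -` {y. \<forall>i\<in>J. y $ i \<le> z $ i} \<inter> space N)"
        unfolding F_def uniq[OF mg, symmetric] by (rule measure_distr) measurable
      also have "X -` {y. \<forall>i\<in>J. y $ i \<le> z $ i} \<inter> space N = (\<Inter>i\<in>J. {\<omega> \<in> space N. X \<omega> $ i \<le> z $ i})"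
        using that by auto
      finally show ?thesis by simp
    qed
    have xp: "x \<in> pos_orthant" and bp: "b \<in> pos_orthant"
      using xb by (auto simp: pos_orthant_def intro: less_le_trans)
    \<comment> \<open>The thresholds are lowered from \<open>b\<close> to \<open>x\<close> in two stages, passing through \<open>w\<close>.\<close>
    define w where "w = (\<chi> i. if i \<in> I then x $ i else b $ i)"
    have le: "x $ i \<le> b $ i" for i using xb by simp
    have "F UNIV b * F I x \<le> F I b * F UNIV w"
      unfolding F_def
      by (rule lattice) (auto simp: w_def sup_vec_def inf_vec_def intro: le_infI1 le_infI2 order_trans[OF _ le])
    moreover have "F UNIV w * F (- I) x \<le> F (- I) b * F UNIV x"
      unfolding F_def
    proof (rule lattice)
      fix y z assume y: "y \<in> {y. \<forall>i\<in>UNIV. y $ i \<le> w $ i}" and z: "z \<in> {y. \<forall>i\<in>- I. y $ i \<le> x $ i}"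
      have "inf y z $ i \<le> x $ i" for i
      proof -
        have "y $ i \<le> w $ i" "i \<notin> I \<Longrightarrow> z $ i \<le> x $ i" using y z by auto
        then show ?thesis
          by (auto simp: w_def inf_vec_def inf_real_def min_le_iff_disj split: if_splits)
      qed
      moreover have "sup y z $ i \<le> b $ i" if "i \<notin> I" for i
        using y z that by (auto simp: w_def sup_vec_def intro: order_trans[OF _ le] dest: spec[of _ i])
      ultimately show "sup y z \<in> {y. \<forall>i\<in>- I. y $ i \<le> b $ i} \<and> inf y z \<in> {y. \<forall>i\<in>UNIV. y $ i \<le> x $ i}"
        by simp
    qed measurable
    ultimately have cross: "F UNIV b * (F I x * F (- I) x) \<le> F UNIV x * (F I b * F (- I) b)"
    proof -
      assume 1: "F UNIV b * F I x \<le> F I b * F UNIV w" and 2: "F UNIV w * F (- I) x \<le> F (- I) b * F UNIV x"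
      have "F UNIV b * (F I x * F (- I) x) = (F UNIV b * F I x) * F (- I) x" by simp
      also have "\<dots> \<le> (F I b * F UNIV w) * F (- I) x"
        using 1 by (rule mult_right_mono) (simp add: F_def)
      also have "\<dots> = F I b * (F UNIV w * F (- I) x)" by simp
      also have "\<dots> \<le> F I b * (F (- I) b * F UNIV x)"
        using 2 by (rule mult_left_mono) (simp add: F_def)
      finally show ?thesis by (simp add: ac_simps)
    qed
    have "F UNIV b / (F I b * F (- I) b) \<le> F UNIV x / (F I x * F (- I) x)"
    proof -
      have "a / B \<le> a' / D" if "a * D \<le> a' * B" "0 < B" "0 < D" for a a' B D :: real
        using that by (simp add: divide_simps mult.commute)
      then show ?thesis
        using cross by (simp only: mult_pos_pos F_pos xp bp)
    qed
    moreover have "- I \<noteq> {}" using I by auto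
    ultimately show ?thesis
      using N_F[of UNIV] N_F[of I] N_F[of "- I"] I by simp
  qed
  show ?thesis
  proof (intro conjI)
    show "\<exists>!M. multivariate_gamma \<alpha> R M" using \<mu> uniq by (rule ex1I)
    show "\<forall>M. multivariate_gamma \<alpha> R M \<longrightarrow>
        (\<exists>c>0.
           distributed M lborel (\<lambda>x. x)
             (\<lambda>x. ennreal (indicator pos_orthant x * (c * gamma_tree_kernel \<alpha> R x))) \<and>
           MTP2 (\<lambda>x. c * gamma_tree_kernel \<alpha> R x)) \<and>
        MTP2 (joint_cdf M)"
    proof (intro allI impI)
      fix M assume "multivariate_gamma \<alpha> R M"
      then have M: "M = \<mu>" by (rule uniq)
      show "(\<exists>c>0.
           distributed M lborel (\<lambda>x. x)
             (\<lambda>x. ennreal (indicator pos_orthant x * (c * gamma_tree_kernel \<alpha> R x))) \<and>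
           MTP2 (\<lambda>x. c * gamma_tree_kernel \<alpha> R x)) \<and>
        MTP2 (joint_cdf M)"
        unfolding M by (intro conjI exI[of _ c] c distributed kernel joint)
    qed
    show "\<forall>(N :: 'w measure) X.
        prob_space N \<and> X \<in> borel_measurable N \<and> multivariate_gamma \<alpha> R (distr N borel X) \<longrightarrow>
        (\<forall>x b I. (\<forall>i. 0 < x $ i \<and> x $ i \<le> b $ i) \<and> I \<noteq> {} \<and> I \<noteq> UNIV \<longrightarrow>
           (let A = (\<lambda>i. {\<omega> \<in> space N. X \<omega> $ i \<le> x $ i});
                B = (\<lambda>i. {\<omega> \<in> space N. X \<omega> $ i \<le> b $ i})
            in measure N (\<Inter>i. A i) / (measure N (\<Inter>i\<in>I. A i) * measure N (\<Inter>i\<in>- I. A i))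
             \<ge> measure N (\<Inter>i. B i) / (measure N (\<Inter>i\<in>I. B i) * measure N (\<Inter>i\<in>- I. B i))))"
      unfolding Let_def
    proof (intro allI impI, elim conjE)
      fix N :: "'w measure" and X and x b :: "(real, 'n) vec" and I :: "'n set"
      assume "prob_space N" "X \<in> borel_measurable N" "multivariate_gamma \<alpha> R (distr N borel X)"
        "\<forall>i. 0 < x $ i \<and> x $ i \<le> b $ i" "I \<noteq> {}" "I \<noteq> UNIV"
      then show "measure N (\<Inter>i. {\<omega> \<in> space N. X \<omega> $ i \<le> b $ i}) /
        (measure N (\<Inter>i\<in>I. {\<omega> \<in> space N. X \<omega> $ i \<le> b $ i}) * measure N (\<Inter>i\<in>- I. {\<omega> \<in> space N. X \<omega> $ i \<le> b $ i}))
      \<le> measure N (\<Inter>i. {\<omega> \<in> space N. X \<omega> $ i \<le> x $ i}) /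
        (measure N (\<Inter>i\<in>I. {\<omega> \<in> space N. X \<omega> $ i \<le> x $ i}) * measure N (\<Inter>i\<in>- I. {\<omega> \<in> space N. X \<omega> $ i \<le> x $ i}))"
        by (rule ratio)
    qed
  qed
qed

end
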